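(* The variety of $\mathbf{UL}_\omega$-algebras and the variety of $\mathbf{IUL}_\omega$-algebras each have the finite embeddability property.
   Context: A $\mathbf{UL}$-algebra is a structure $\mathcal A=\langle A,\wedge,\vee,\cdot,\to,e,f,\bot,\top\rangle$ satisfying the following. $\langle A,\wedge,\vee,\bot,\top\rangle$ is a bounded lattice. $\langle A,\cdot,e\rangle$ is a commutative monoid. For all $x,y,z$: $xy\le z$ iff $y\le x\to z$. For all $x,y,u,v$: $$\lambda_u((x\vee y)\to x)\vee\lambda_v((x\vee y)\to y)=e,\quad\text{where } \lambda_a(b)=(a\to ba)\wedge e.$$ (Equivalently, it is a bounded semilinear commutative residuated lattice with an extra constant $f$.) Here $f$ is an arbitrary constant. A $\mathbf{UL}_\omega$-algebra is a $\mathbf{UL}$-algebra satisfying $x\to e=x^2\to e$ for all $x$, where $x^2=x\cdot x$. An $\mathbf{IUL}_\omega$-algebra is a $\mathbf{UL}_\omega$-algebra satisfying $\neg\neg x=x$ for all $x$, where $\neg x=x\to f$. Partial subalgebra: given an ordered algebra $\mathcal A$ and a nonempty $B\subseteq A$, the partial subalgebra $\mathcal B$ with domain $B$ carries the restricted order. For each operation $g$, $g^{\mathcal B}(b_1,\dots,b_k)=g^{\mathcal A}(b_1,\dots,b_k)$ if this value lies in $B$, and is undefined otherwise. Partial embedding of $\mathcal B$ into an ordered algebra $\mathcal C$: an injective map $\iota:B\to C$ with $a\le b\iff\iota(a)\le\iota(b)$, and $\iota(g^{\mathcal B}(b_1,\dots,b_k))=g^{\mathcal C}(\iota(b_1),\dots,\iota(b_k))$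 whenever the left side is defined. A class $\mathbf K$ has the finite embeddability property (FEP) if every finite partial subalgebra of any member of $\mathbf K$ can be partially embedded into some finite member of $\mathbf K$. *)

theory Defs
  imports Main
begin

record 'a ul_alg =
  carrier :: "'a set"
  meet :: "'a \<Rightarrow> 'a \<Rightarrow> 'a"
  join :: "'a \<Rightarrow> 'a \<Rightarrow> 'a"
  mult :: "'a \<Rightarrow> 'a \<Rightarrow> 'a"
  imp  :: "'a \<Rightarrow> 'a \<Rightarrow> 'a"
  unit_e :: 'a
  const_f :: 'a
  bot_c :: 'a
  top_c :: 'a

definition leq :: "'a ul_alg \<Rightarrow> 'a \<Rightarrow> 'a \<Rightarrow> bool" where
  "leq A x y \<longleftrightarrow> meet A x y = x"

definition lam :: "'a ul_alg \<Rightarrow> 'a \<Rightarrow> 'a \<Rightarrow> 'a" where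
  "lam A a b = meet A (imp A a (mult A b a)) (unit_e A)"

definition UL_alg :: "'a ul_alg \<Rightarrow> bool" where
  "UL_alg A \<longleftrightarrow>
    (let S = carrier A in
     \<comment> \<open>closure\<close>
     (\<forall>x\<in>S. \<forall>y\<in>S. meet A x y \<in> S \<and> join A x y \<in> S \<and> mult A x y \<in> S \<and> imp A x y \<in> S)
   \<and> unit_e A \<in> S \<and> const_f A \<in> S \<and> bot_c A \<in> S \<and> top_c A \<in> S
     \<comment> \<open>bounded lattice\<close>
   \<and> (\<forall>x\<in>S. \<forall>y\<in>S. \<forall>z\<in>S. meet A x (meet A y z) = meet A (meet A x y) z
                         \<and> join A x (join A y z) = join A (join A x y) z)
   \<and> (\<forall>x\<in>S. \<forall>y\<in>S. meet A x y = meet A y x \<and> join A x y = join A y x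
                   \<and> meet A x (join A x y) = x \<and> join A x (meet A x y) = x)
   \<and> (\<forall>x\<in>S. meet A x x = x \<and> join A x x = x)
   \<and> (\<forall>x\<in>S. leq A (bot_c A) x \<and> leq A x (top_c A))
     \<comment> \<open>commutative monoid\<close>
   \<and> (\<forall>x\<in>S. \<forall>y\<in>S. \<forall>z\<in>S. mult A x (mult A y z) = mult A (mult A x y) z)
   \<and> (\<forall>x\<in>S. \<forall>y\<in>S. mult A x y = mult A y x)
   \<and> (\<forall>x\<in>S. mult A (unit_e A) x = x)
     \<comment> \<open>residuation\<close>
   \<and> (\<forall>x\<in>S. \<forall>y\<in>S. \<forall>z\<in>S. leq A (mult A x y) z \<longleftrightarrow> leq A y (imp A x z))
     \<comment> \<open>semilinearity\<close>
   \<and> (\<forall>x\<in>S. \<forall>y\<in>S. \<forall>u\<in>S. \<forall>v\<in>S.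
        join A (lam A u (imp A (join A x y) x)) (lam A v (imp A (join A x y) y)) = unit_e A))"

definition UL_omega_alg :: "'a ul_alg \<Rightarrow> bool" where
  "UL_omega_alg A \<longleftrightarrow> UL_alg A \<and>
     (\<forall>x\<in>carrier A. imp A x (unit_e A) = imp A (mult A x x) (unit_e A))"

definition neg :: "'a ul_alg \<Rightarrow> 'a \<Rightarrow> 'a" where
  "neg A x = imp A x (const_f A)"

definition IUL_omega_alg :: "'a ul_alg \<Rightarrow> bool" where
  "IUL_omega_alg A \<longleftrightarrow> UL_omega_alg A \<and> (\<forall>x\<in>carrier A. neg A (neg A x) = x)"

text \<open>A partial embedding of the partial subalgebra of A with domain B into C.
  An operation of the partial subalgebra is defined at arguments in B iff its value
  in A lies in B; constants likewise.\<close>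
definition partial_embedding ::
  "'a ul_alg \<Rightarrow> 'a set \<Rightarrow> 'b ul_alg \<Rightarrow> ('a \<Rightarrow> 'b) \<Rightarrow> bool" where
  "partial_embedding A B C \<iota> \<longleftrightarrow>
     inj_on \<iota> B \<and> \<iota> ` B \<subseteq> carrier C
   \<and> (\<forall>a\<in>B. \<forall>b\<in>B. leq A a b \<longleftrightarrow> leq C (\<iota> a) (\<iota> b))
   \<and> (\<forall>a\<in>B. \<forall>b\<in>B.
        (meet A a b \<in> B \<longrightarrow> \<iota> (meet A a b) = meet C (\<iota> a) (\<iota> b))
      \<and> (join A a b \<in> B \<longrightarrow> \<iota> (join A a b) = join C (\<iota> a) (\<iota> b))
      \<and> (mult A a b \<in> B \<longrightarrow> \<iota> (mult A a b) = mult C (\<iota> a) (\<iota> b))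
      \<and> (imp A a b \<in> B \<longrightarrow> \<iota> (imp A a b) = imp C (\<iota> a) (\<iota> b)))
   \<and> (unit_e A \<in> B \<longrightarrow> \<iota> (unit_e A) = unit_e C)
   \<and> (const_f A \<in> B \<longrightarrow> \<iota> (const_f A) = const_f C)
   \<and> (bot_c A \<in> B \<longrightarrow> \<iota> (bot_c A) = bot_c C)
   \<and> (top_c A \<in> B \<longrightarrow> \<iota> (top_c A) = top_c C)"

text \<open>FEP of a class: K is the class at the source type, K' the same class at the
  type of the finite target algebras (nat, which suffices up to isomorphism).\<close>
definition FEP :: "('a ul_alg \<Rightarrow> bool) \<Rightarrow> ('b ul_alg \<Rightarrow> bool) \<Rightarrow> bool" where
  "FEP K K' \<longleftrightarrow>
     (\<forall>A B. K A \<and> B \<noteq> {} \<and> finite B \<and> B \<subseteq> carrier A \<longrightarrow>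
        (\<exists>C \<iota>. K' C \<and> finite (carrier C) \<and> partial_embedding A B C \<iota>))"

end

(*
Semilinearity makes the prime filters F of an algebra separate its elements, and each F turns
the algebra into a totally preordered monoid by letting x \<preceq> y iff x \<rightharpoonup> y lies in F.

Let M be the submonoid generated by a finite set B containing the constants. The sets
{x in M. u x \<preceq> b} with u in M and b in B are linearly ordered by inclusion and closed under
residuals, so once they are finite in number they form a finite chain algebra into which B embeds
up to the preorder. Finiteness uses x \<rightharpoonup> e = x^2 \<rightharpoonup> e: whether a product of generators is
\<preceq> e depends only on which generators occur in it. Infinitely many such sets for one b would give
sequences m and x in M with m_l x_i \<preceq> b iff i < l (or iff l \<le> i). After thinning out so that every
exponent is constant or strictly increasing, the quotient of m_k x_l by m_i x_j (i < k, j < l) has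
constant support, hence these products all move in one direction, which is incompatible with the
ladder pattern.

A finite product of such chains, one for each pair a, b in B with a not below b, separates B. If
negation is involutive and B is closed under it, every one of the sets has the form
{x in M. w x \<preceq> f}, so double negation is the identity on the chain as well.
*)
theory Submission
  imports Defs "HOL-Library.Infinite_Set" "HOL-Library.FuncSet"
begin

section \<open>Order and multiplication in a UL-algebra\<close>

locale ul =
  fixes A :: "'a ul_alg"
  assumes UL: "UL_alg A"
begin

abbreviation "S \<equiv> carrier A"
abbreviation le (infix "\<sqsubseteq>" 50) where "x \<sqsubseteq> y \<equiv> leq A x y"
abbreviation mt (infixl "\<sqinter>" 70) where "x \<sqinter> y \<equiv> meet A x y"
abbreviation jn (infixl "\<squnion>" 65) where "x \<squnion> y \<equiv> join A x y"
abbreviation ml (infixl "\<otimes>" 70) where "x \<otimes> y \<equiv> mult A x y"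
abbreviation im (infixr "\<rightharpoonup>" 60) where "x \<rightharpoonup> y \<equiv> imp A x y"
abbreviation un ("\<one>") where "\<one> \<equiv> unit_e A"

lemma closed [simp, intro]:
  "x \<in> S \<Longrightarrow> y \<in> S \<Longrightarrow> x \<sqinter> y \<in> S"
  "x \<in> S \<Longrightarrow> y \<in> S \<Longrightarrow> x \<squnion> y \<in> S"
  "x \<in> S \<Longrightarrow> y \<in> S \<Longrightarrow> x \<otimes> y \<in> S"
  "x \<in> S \<Longrightarrow> y \<in> S \<Longrightarrow> x \<rightharpoonup> y \<in> S"
  "\<one> \<in> S" "const_f A \<in> S" "bot_c A \<in> S" "top_c A \<in> S"
  using UL unfolding UL_alg_def Let_def by simp_all

lemma meet_assoc: "x \<in> S \<Longrightarrow> y \<in> S \<Longrightarrow> z \<in> S \<Longrightarrow> x \<sqinter> (y \<sqinter> z) = x \<sqinter> y \<sqinter> z"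
  and join_assoc: "x \<in> S \<Longrightarrow> y \<in> S \<Longrightarrow> z \<in> S \<Longrightarrow> x \<squnion> (y \<squnion> z) = x \<squnion> y \<squnion> z"
  and meet_comm: "x \<in> S \<Longrightarrow> y \<in> S \<Longrightarrow> x \<sqinter> y = y \<sqinter> x"
  and join_comm: "x \<in> S \<Longrightarrow> y \<in> S \<Longrightarrow> x \<squnion> y = y \<squnion> x"
  and absorb1: "x \<in> S \<Longrightarrow> y \<in> S \<Longrightarrow> x \<sqinter> (x \<squnion> y) = x"
  and absorb2: "x \<in> S \<Longrightarrow> y \<in> S \<Longrightarrow> x \<squnion> (x \<sqinter> y) = x"
  and meet_idem: "x \<in> S \<Longrightarrow> x \<sqinter> x = x"
  and join_idem: "x \<in> S \<Longrightarrow> x \<squnion> x = x"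
  and bot_le: "x \<in> S \<Longrightarrow> bot_c A \<sqsubseteq> x"
  and le_top: "x \<in> S \<Longrightarrow> x \<sqsubseteq> top_c A"
  and mult_assoc: "x \<in> S \<Longrightarrow> y \<in> S \<Longrightarrow> z \<in> S \<Longrightarrow> x \<otimes> (y \<otimes> z) = x \<otimes> y \<otimes> z"
  and mult_comm: "x \<in> S \<Longrightarrow> y \<in> S \<Longrightarrow> x \<otimes> y = y \<otimes> x"
  and unit_left [simp]: "x \<in> S \<Longrightarrow> \<one> \<otimes> x = x"
  and residuation: "x \<in> S \<Longrightarrow> y \<in> S \<Longrightarrow> z \<in> S \<Longrightarrow> x \<otimes> y \<sqsubseteq> z \<longleftrightarrow> y \<sqsubseteq> x \<rightharpoonup> z"
  and semilinear: "x \<in> S \<Longrightarrow> y \<in> S \<Longrightarrow> u \<in> S \<Longrightarrow> v \<in> S \<Longrightarrow>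
        lam A u (x \<squnion> y \<rightharpoonup> x) \<squnion> lam A v (x \<squnion> y \<rightharpoonup> y) = \<one>"
  using UL unfolding UL_alg_def Let_def by blast+

lemma unit_right [simp]: "x \<in> S \<Longrightarrow> x \<otimes> \<one> = x"
  using mult_comm[of x \<one>] by simp

lemma le_refl [simp]: "x \<in> S \<Longrightarrow> x \<sqsubseteq> x"
  by (simp add: leq_def meet_idem)

lemma le_trans: "x \<sqsubseteq> y \<Longrightarrow> y \<sqsubseteq> z \<Longrightarrow> x \<in> S \<Longrightarrow> y \<in> S \<Longrightarrow> z \<in> S \<Longrightarrow> x \<sqsubseteq> z"
  unfolding leq_def by (metis meet_assoc)

lemma le_antisym: "x \<sqsubseteq> y \<Longrightarrow> y \<sqsubseteq> x \<Longrightarrow> x \<in> S \<Longrightarrow> y \<in> S \<Longrightarrow> x = y"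
  unfolding leq_def by (metis meet_comm)

lemma le_iff_join: "x \<in> S \<Longrightarrow> y \<in> S \<Longrightarrow> x \<sqsubseteq> y \<longleftrightarrow> x \<squnion> y = y"
  unfolding leq_def by (metis absorb1 absorb2 join_comm meet_comm)

lemma meet_le1 [simp]: "x \<in> S \<Longrightarrow> y \<in> S \<Longrightarrow> x \<sqinter> y \<sqsubseteq> x"
  and meet_le2 [simp]: "x \<in> S \<Longrightarrow> y \<in> S \<Longrightarrow> x \<sqinter> y \<sqsubseteq> y"
  unfolding leq_def by (simp add: meet_comm[of "x \<sqinter> y"] meet_assoc meet_idem,
      simp add: meet_idem flip: meet_assoc)

lemma meet_greatest: "z \<sqsubseteq> x \<Longrightarrow> z \<sqsubseteq> y \<Longrightarrow> x \<in> S \<Longrightarrow> y \<in> S \<Longrightarrow> z \<in> S \<Longrightarrow> z \<sqsubseteq> x \<sqinter> y"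
  by (simp add: leq_def meet_assoc)

lemma join_ge1 [simp]: "x \<in> S \<Longrightarrow> y \<in> S \<Longrightarrow> x \<sqsubseteq> x \<squnion> y"
  and join_ge2 [simp]: "x \<in> S \<Longrightarrow> y \<in> S \<Longrightarrow> y \<sqsubseteq> x \<squnion> y"
  unfolding leq_def by (metis absorb1 join_comm)+

lemma join_least: "x \<sqsubseteq> z \<Longrightarrow> y \<sqsubseteq> z \<Longrightarrow> x \<in> S \<Longrightarrow> y \<in> S \<Longrightarrow> z \<in> S \<Longrightarrow> x \<squnion> y \<sqsubseteq> z"
  by (metis closed(2) join_assoc le_iff_join)

lemma mult_mono1: "x \<sqsubseteq> y \<Longrightarrow> x \<in> S \<Longrightarrow> y \<in> S \<Longrightarrow> z \<in> S \<Longrightarrow> z \<otimes> x \<sqsubseteq> z \<otimes> y"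
  by (simp add: residuation le_trans[of x y "z \<rightharpoonup> z \<otimes> y"] flip: residuation[of z y])

lemma mult_mono: "x \<sqsubseteq> y \<Longrightarrow> x' \<sqsubseteq> y' \<Longrightarrow> x \<in> S \<Longrightarrow> y \<in> S \<Longrightarrow> x' \<in> S \<Longrightarrow> y' \<in> S
    \<Longrightarrow> x \<otimes> x' \<sqsubseteq> y \<otimes> y'"
  using mult_mono1[of x y x'] mult_mono1[of x' y' y]
  by (simp add: mult_comm[of _ x'] le_trans[of "x' \<otimes> x" "x' \<otimes> y"])

lemma imp_mp: "x \<in> S \<Longrightarrow> y \<in> S \<Longrightarrow> x \<otimes> (x \<rightharpoonup> y) \<sqsubseteq> y"
  by (simp add: residuation)

lemma e_le_imp: "x \<in> S \<Longrightarrow> y \<in> S \<Longrightarrow> \<one> \<sqsubseteq> x \<rightharpoonup> y \<longleftrightarrow> x \<sqsubseteq> y"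
  by (simp flip: residuation)

lemma mult_join_le:
  "x \<otimes> y \<sqsubseteq> w \<Longrightarrow> x \<otimes> z \<sqsubseteq> w \<Longrightarrow> x \<in> S \<Longrightarrow> y \<in> S \<Longrightarrow> z \<in> S \<Longrightarrow> w \<in> S
    \<Longrightarrow> x \<otimes> (y \<squnion> z) \<sqsubseteq> w"
  by (simp add: residuation join_least)

text \<open>After distributing, every term with a factor \<open>q\<close> lies below
  \<open>q\<close>, because the other factor is at most \<open>\<one>\<close>. This makes the
  filters of \<open>filter_extend\<close> closed under products.\<close>

lemma join_mult_join_le:
  assumes "x \<in> S" "y \<in> S" "q \<in> S" "x \<sqsubseteq> \<one>" "y \<sqsubseteq> \<one>" "q \<sqsubseteq> \<one>"
  shows "(x \<squnion> q) \<otimes> (y \<squnion> q) \<sqsubseteq> x \<otimes> y \<squnion> q"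
proof -
  have 1: "x \<otimes> q \<sqsubseteq> q" "y \<otimes> q \<sqsubseteq> q" "q \<otimes> q \<sqsubseteq> q"
    using mult_mono[of _ \<one> q q] assms by (metis closed(5) le_refl unit_left)+
  let ?w = "x \<otimes> y \<squnion> q"
  have q: "t \<sqsubseteq> q \<Longrightarrow> t \<in> S \<Longrightarrow> t \<sqsubseteq> ?w" for t
    by (rule le_trans[of _ q]) (use assms in auto)
  have "y \<otimes> x \<sqsubseteq> ?w" "y \<otimes> q \<sqsubseteq> ?w" "q \<otimes> x \<sqsubseteq> ?w" "q \<otimes> q \<sqsubseteq> ?w"
    using q 1 assms by (simp_all add: mult_comm[of y x] mult_comm[of q x])
  then have "y \<otimes> (x \<squnion> q) \<sqsubseteq> ?w" "q \<otimes> (x \<squnion> q) \<sqsubseteq> ?w"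
    using assms by (simp_all add: mult_join_le)
  then show ?thesis
    using assms by (intro mult_join_le) (simp_all add: mult_comm[of y] mult_comm[of q])
qed

text \<open>For \<open>u = v = \<one>\<close> the terms \<open>lam\<close> of the semilinearity
  axiom reduce to plain meets with \<open>\<one>\<close>. Replacing the premise
  \<open>x \<squnion> y\<close> by the smaller \<open>y\<close> or \<open>x\<close> only enlarges
  the residual.\<close>

lemma prelinear:
  assumes "x \<in> S" "y \<in> S"
  shows "(x \<rightharpoonup> y) \<sqinter> \<one> \<squnion> (y \<rightharpoonup> x) \<sqinter> \<one> = \<one>"
proof -
  have lam: "lam A \<one> b = b \<sqinter> \<one>" if "b \<in> S" for b
  proof -
    have "\<one> \<rightharpoonup> b = b"
    proof (rule le_antisym)
      show "\<one> \<rightharpoonup> b \<sqsubseteq> b" using imp_mp[of \<one> b] that by simp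
      show "b \<sqsubseteq> \<one> \<rightharpoonup> b" using that by (simp flip: residuation)
    qed (use that in auto)
    then show ?thesis unfolding lam_def using that by simp
  qed
  have mono: "(x \<squnion> y \<rightharpoonup> z) \<sqinter> \<one> \<sqsubseteq> (w \<rightharpoonup> z) \<sqinter> \<one>" if "w \<sqsubseteq> x \<squnion> y" "w \<in> S" "z \<in> S" for w z
  proof -
    have "w \<otimes> (x \<squnion> y \<rightharpoonup> z) \<sqsubseteq> (x \<squnion> y) \<otimes> (x \<squnion> y \<rightharpoonup> z)"
      using that assms by (intro mult_mono) auto
    then have "w \<otimes> (x \<squnion> y \<rightharpoonup> z) \<sqsubseteq> z"
      by (rule le_trans) (use that assms imp_mp in auto)
    then have "(x \<squnion> y \<rightharpoonup> z) \<sqsubseteq> w \<rightharpoonup> z" using that assms by (simp add: residuation)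
    then have "(x \<squnion> y \<rightharpoonup> z) \<sqinter> \<one> \<sqsubseteq> w \<rightharpoonup> z"
      by (rule le_trans[rotated]) (use that assms in auto)
    then show ?thesis using that assms by (intro meet_greatest) auto
  qed
  let ?r = "(x \<rightharpoonup> y) \<sqinter> \<one> \<squnion> (y \<rightharpoonup> x) \<sqinter> \<one>"
  have 1: "(x \<squnion> y \<rightharpoonup> x) \<sqinter> \<one> \<squnion> (x \<squnion> y \<rightharpoonup> y) \<sqinter> \<one> = \<one>"
    using semilinear[of x y \<one> \<one>] assms by (simp add: lam)
  have "(x \<squnion> y \<rightharpoonup> x) \<sqinter> \<one> \<sqsubseteq> ?r"
    by (rule le_trans[OF mono[of y x]]) (use assms in auto)
  moreover have "(x \<squnion> y \<rightharpoonup> y) \<sqinter> \<one> \<sqsubseteq> ?r"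
    by (rule le_trans[OF mono[of x y]]) (use assms in auto)
  ultimately have "\<one> \<sqsubseteq> ?r"
    using join_least[of "(x \<squnion> y \<rightharpoonup> x) \<sqinter> \<one>" ?r "(x \<squnion> y \<rightharpoonup> y) \<sqinter> \<one>"] assms 1 by auto
  moreover have "?r \<sqsubseteq> \<one>" using assms by (intro join_least) auto
  ultimately show ?thesis using assms by (intro le_antisym) auto
qed

section \<open>Deductive filters and prime filters\<close>

text \<open>Products and \<open>x \<sqinter> \<one>\<close> together give closure under binary
  meets, since \<open>(x \<sqinter> \<one>) \<otimes> (y \<sqinter> \<one>) \<sqsubseteq> x
  \<sqinter> y\<close>.\<close>

definition is_filter :: "'a set \<Rightarrow> bool" where
  "is_filter F \<longleftrightarrow> F \<subseteq> S \<and> \<one> \<in> F \<and> (\<forall>x\<in>F. \<forall>y\<in>S. x \<sqsubseteq> y \<longrightarrow> y \<in> F)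
     \<and> (\<forall>x\<in>F. \<forall>y\<in>F. x \<otimes> y \<in> F) \<and> (\<forall>x\<in>F. x \<sqinter> \<one> \<in> F)"

text \<open>An analogue of the ideal quotient of \<open>F\<close> by \<open>q\<close>. For
  \<open>F\<close> maximal among the filters omitting \<open>c\<close>, this quotient equals
  \<open>F\<close> or contains \<open>c\<close>, and that alternative yields primeness.\<close>

lemma filter_extend:
  assumes F: "is_filter F" and q: "q \<in> S" "q \<sqsubseteq> \<one>"
  shows "is_filter {z \<in> S. z \<sqinter> \<one> \<squnion> q \<in> F}" and "F \<subseteq> {z \<in> S. z \<sqinter> \<one> \<squnion> q \<in> F}"
proof -
  have FS: "x \<in> S" if "x \<in> F" for x using F that unfolding is_filter_def by auto
  have up: "y \<in> F" if "x \<in> F" "x \<sqsubseteq> y" "y \<in> S" for x y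
    using F that unfolding is_filter_def by blast
  have e: "\<one> \<in> F" using F unfolding is_filter_def by blast
  have mul: "x \<otimes> y \<in> F" if "x \<in> F" "y \<in> F" for x y
    using F that unfolding is_filter_def by blast
  have me: "x \<sqinter> \<one> \<in> F" if "x \<in> F" for x using F that unfolding is_filter_def by blast
  show "F \<subseteq> {z \<in> S. z \<sqinter> \<one> \<squnion> q \<in> F}"
  proof
    fix x assume x: "x \<in> F"
    show "x \<in> {z \<in> S. z \<sqinter> \<one> \<squnion> q \<in> F}"
      using up[OF me[OF x], of "x \<sqinter> \<one> \<squnion> q"] FS[OF x] q by simp
  qed
  then have e': "\<one> \<in> {z \<in> S. z \<sqinter> \<one> \<squnion> q \<in> F}"
    using F unfolding is_filter_def by blast
  have ups: "y \<in> {z \<in> S. z \<sqinter> \<one> \<squnion> q \<in> F}"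
    if "x \<in> {z \<in> S. z \<sqinter> \<one> \<squnion> q \<in> F}" "y \<in> S" "x \<sqsubseteq> y" for x y
  proof -
    have xS: "x \<in> S" using that by auto
    have "x \<sqinter> \<one> \<sqsubseteq> y" by (rule le_trans[of _ x]) (use that xS in auto)
    then have "x \<sqinter> \<one> \<sqsubseteq> y \<sqinter> \<one>" using that xS by (intro meet_greatest) auto
    then have "x \<sqinter> \<one> \<sqsubseteq> y \<sqinter> \<one> \<squnion> q" by (rule le_trans) (use that xS q in auto)
    then have "x \<sqinter> \<one> \<squnion> q \<sqsubseteq> y \<sqinter> \<one> \<squnion> q" using that xS q by (intro join_least) auto
    then show ?thesis using up that xS q by auto
  qed
  have muls: "x \<otimes> y \<in> {z \<in> S. z \<sqinter> \<one> \<squnion> q \<in> F}"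
    if "x \<in> {z \<in> S. z \<sqinter> \<one> \<squnion> q \<in> F}" "y \<in> {z \<in> S. z \<sqinter> \<one> \<squnion> q \<in> F}" for x y
  proof -
    have xS: "x \<in> S" "y \<in> S" using that by auto
    have "(x \<sqinter> \<one> \<squnion> q) \<otimes> (y \<sqinter> \<one> \<squnion> q) \<in> F" using mul that by auto
    moreover have "(x \<sqinter> \<one> \<squnion> q) \<otimes> (y \<sqinter> \<one> \<squnion> q) \<sqsubseteq> (x \<sqinter> \<one>) \<otimes> (y \<sqinter> \<one>) \<squnion> q"
      using xS q by (intro join_mult_join_le) auto
    moreover have "(x \<sqinter> \<one>) \<otimes> (y \<sqinter> \<one>) \<squnion> q \<sqsubseteq> (x \<otimes> y) \<sqinter> \<one> \<squnion> q"
    proof -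
      have "(x \<sqinter> \<one>) \<otimes> (y \<sqinter> \<one>) \<sqsubseteq> x \<otimes> y" using xS by (intro mult_mono) auto
      moreover have "(x \<sqinter> \<one>) \<otimes> (y \<sqinter> \<one>) \<sqsubseteq> \<one>"
        using mult_mono[of "x \<sqinter> \<one>" \<one> "y \<sqinter> \<one>" \<one>] xS by auto
      ultimately have "(x \<sqinter> \<one>) \<otimes> (y \<sqinter> \<one>) \<sqsubseteq> (x \<otimes> y) \<sqinter> \<one>" using xS by (intro meet_greatest) auto
      then have "(x \<sqinter> \<one>) \<otimes> (y \<sqinter> \<one>) \<sqsubseteq> (x \<otimes> y) \<sqinter> \<one> \<squnion> q" by (rule le_trans) (use xS q in auto)
      then show ?thesis using xS q by (intro join_least) auto
    qed
    ultimately have "(x \<otimes> y) \<sqinter> \<one> \<squnion> q \<in> F" using up xS q by (meson closed)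
    then show ?thesis using xS by auto
  qed
  have mes: "x \<sqinter> \<one> \<in> {z \<in> S. z \<sqinter> \<one> \<squnion> q \<in> F}" if "x \<in> {z \<in> S. z \<sqinter> \<one> \<squnion> q \<in> F}" for x
    using that meet_idem by (auto simp flip: meet_assoc)
  show "is_filter {z \<in> S. z \<sqinter> \<one> \<squnion> q \<in> F}"
    unfolding is_filter_def using e' ups muls mes by blast
qed

lemma filter_Union_chain:
  assumes "\<C> \<noteq> {}" "\<And>F. F \<in> \<C> \<Longrightarrow> is_filter F" "\<And>F G. F \<in> \<C> \<Longrightarrow> G \<in> \<C> \<Longrightarrow> F \<subseteq> G \<or> G \<subseteq> F"
  shows "is_filter (\<Union>\<C>)"
proof -
  have "x \<otimes> y \<in> \<Union>\<C>" if xy: "x \<in> \<Union>\<C>" "y \<in> \<Union>\<C>" for x y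
  proof -
    obtain F G where "F \<in> \<C>" "G \<in> \<C>" "x \<in> F" "y \<in> G" using xy by blast
    then obtain H where "H \<in> \<C>" "x \<in> H" "y \<in> H" using assms(3) by blast
    then show ?thesis using assms(2)[of H] unfolding is_filter_def by blast
  qed
  moreover have "\<one> \<in> \<Union>\<C>" "\<Union>\<C> \<subseteq> S" "\<forall>x\<in>\<Union>\<C>. \<forall>y\<in>S. x \<sqsubseteq> y \<longrightarrow> y \<in> \<Union>\<C>" "\<forall>x\<in>\<Union>\<C>. x \<sqinter> \<one> \<in> \<Union>\<C>"
    using assms(1,2) unfolding is_filter_def by blast+
  ultimately show ?thesis unfolding is_filter_def by blast
qed

text \<open>A filter that is maximal among those omitting \<open>c\<close> contains one of any two
  elements below \<open>\<one>\<close> whose join is \<open>\<one>\<close>. Applied to the two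
  joinands of \<open>prelinear\<close>, this decides between a residual and its converse.\<close>

lemma prime_filter_exists:
  assumes "c \<in> S" "\<not> \<one> \<sqsubseteq> c"
  obtains F where "is_filter F" "c \<notin> F" "\<And>x y. x \<in> S \<Longrightarrow> y \<in> S \<Longrightarrow> x \<rightharpoonup> y \<in> F \<or> y \<rightharpoonup> x \<in> F"
proof -
  let ?\<F> = "{F. is_filter F \<and> c \<notin> F}"
  have me: "\<one> \<sqsubseteq> x \<otimes> y" if "\<one> \<sqsubseteq> x" "\<one> \<sqsubseteq> y" "x \<in> S" "y \<in> S" for x y
    using mult_mono[of \<one> x \<one> y] that by auto
  \<comment> \<open>The upper set of \<open>\<one>\<close> omits \<open>c\<close> by hypothesis,
    which gives Zorn's lemma a nonempty family.\<close>
  have "is_filter {x \<in> S. \<one> \<sqsubseteq> x}"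
    unfolding is_filter_def using me by (auto intro: le_trans meet_greatest)
  then have "?\<F> \<noteq> {}" using assms by auto
  moreover have "\<Union>\<C> \<in> ?\<F>" if "\<C> \<noteq> {}" "subset.chain ?\<F> \<C>" for \<C>
    using that filter_Union_chain[of \<C>] unfolding subset.chain_def by blast
  ultimately obtain F where F: "F \<in> ?\<F>" and mx: "\<forall>X\<in>?\<F>. F \<subseteq> X \<longrightarrow> X = F"
    using subset_Zorn_nonempty[of ?\<F>] by blast
  have up: "y \<in> F" if "x \<in> F" "x \<sqsubseteq> y" "y \<in> S" for x y
    using F that unfolding is_filter_def by blast
  have e: "\<one> \<in> F" using F unfolding is_filter_def by blast
  have prime: "p \<in> F \<or> q \<in> F" if pq: "p \<in> S" "q \<in> S" "p \<sqsubseteq> \<one>" "q \<sqsubseteq> \<one>" "p \<squnion> q = \<one>" for p q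
  proof -
    let ?G = "\<lambda>q. {z \<in> S. z \<sqinter> \<one> \<squnion> q \<in> F}"
    have Gmax: "?G r = F" if "r \<in> S" "r \<sqsubseteq> \<one>" "c \<notin> ?G r" for r
      using filter_extend[of F r] mx F that by blast
    show ?thesis
    proof (cases "c \<in> ?G q")
      case False
      moreover have "p \<in> ?G q" using pq e by (simp add: leq_def)
      ultimately show ?thesis using Gmax[of q] pq by blast
    next
      \<comment> \<open>The roles are exchanged:
        \<open>c \<sqinter> \<one> \<squnion> q \<in> F\<close> puts \<open>q\<close> into the
        quotient by \<open>c \<sqinter> \<one>\<close>. That quotient omits \<open>c\<close>, since
        otherwise \<open>c \<sqinter> \<one>\<close> and hence \<open>c\<close> would be in
        \<open>F\<close>; so it equals \<open>F\<close>.\<close>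
      case True
      then have "c \<sqinter> \<one> \<squnion> q \<in> F" by blast
      moreover have "q \<sqinter> \<one> = q" using pq by (simp add: leq_def)
      ultimately have "q \<in> ?G (c \<sqinter> \<one>)" using pq assms join_comm[of q "c \<sqinter> \<one>"] by simp
      moreover have "c \<notin> ?G (c \<sqinter> \<one>)"
        using F assms up[of "c \<sqinter> \<one>" c] by (auto simp: join_idem)
      ultimately show ?thesis using Gmax[of "c \<sqinter> \<one>"] assms by auto
    qed
  qed
  have "x \<rightharpoonup> y \<in> F \<or> y \<rightharpoonup> x \<in> F" if "x \<in> S" "y \<in> S" for x y
    using prime[of "(x \<rightharpoonup> y) \<sqinter> \<one>" "(y \<rightharpoonup> x) \<sqinter> \<one>"] prelinear[of x y] that
      up[of "(x \<rightharpoonup> y) \<sqinter> \<one>" "x \<rightharpoonup> y"] up[of "(y \<rightharpoonup> x) \<sqinter> \<one>" "y \<rightharpoonup> x"] by auto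
  then show ?thesis using that F by blast
qed

end

section \<open>Total residuated preorders\<close>

text \<open>The order of a totally ordered quotient, pulled back to \<open>A\<close> so that no
  equivalence classes have to be formed. With \<open>total\<close>, the last two axioms make meet
  and join act as minimum and maximum.\<close>

locale ul_preorder = ul +
  fixes R :: "'a \<Rightarrow> 'a \<Rightarrow> bool" (infix "\<preceq>" 50)
  assumes ext: "x \<in> S \<Longrightarrow> y \<in> S \<Longrightarrow> x \<sqsubseteq> y \<Longrightarrow> x \<preceq> y"
    and trans: "x \<in> S \<Longrightarrow> y \<in> S \<Longrightarrow> z \<in> S \<Longrightarrow> x \<preceq> y \<Longrightarrow> y \<preceq> z \<Longrightarrow> x \<preceq> z"
    and total: "x \<in> S \<Longrightarrow> y \<in> S \<Longrightarrow> x \<preceq> y \<or> y \<preceq> x"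
    and resid: "x \<in> S \<Longrightarrow> y \<in> S \<Longrightarrow> z \<in> S \<Longrightarrow> x \<otimes> y \<preceq> z \<longleftrightarrow> y \<preceq> x \<rightharpoonup> z"
    and meet_iff: "x \<in> S \<Longrightarrow> y \<in> S \<Longrightarrow> z \<in> S \<Longrightarrow> z \<preceq> x \<sqinter> y \<longleftrightarrow> z \<preceq> x \<and> z \<preceq> y"
    and join_iff: "x \<in> S \<Longrightarrow> y \<in> S \<Longrightarrow> z \<in> S \<Longrightarrow> x \<squnion> y \<preceq> z \<longleftrightarrow> x \<preceq> z \<and> y \<preceq> z"

text \<open>The relation is \<open>x \<rightharpoonup> y \<in> F\<close> for a prime filter
  \<open>F\<close> omitting \<open>a \<rightharpoonup> b\<close>. Totality is primeness, and
  transitivity is closure of \<open>F\<close> under products.\<close>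

lemma (in ul) preorder_exists:
  assumes ab: "a \<in> S" "b \<in> S" "\<not> a \<sqsubseteq> b"
  obtains R where "ul_preorder A R" "\<not> R a b"
proof -
  obtain F where F: "is_filter F" "a \<rightharpoonup> b \<notin> F"
    and tot: "\<And>x y. x \<in> S \<Longrightarrow> y \<in> S \<Longrightarrow> x \<rightharpoonup> y \<in> F \<or> y \<rightharpoonup> x \<in> F"
    using prime_filter_exists[of "a \<rightharpoonup> b"] ab by (auto simp: e_le_imp)
  have FS: "x \<in> S" if "x \<in> F" for x using F that unfolding is_filter_def by auto
  have up: "y \<in> F" if "x \<in> F" "x \<sqsubseteq> y" "y \<in> S" for x y
    using F that unfolding is_filter_def by blast
  have e: "\<one> \<in> F" using F unfolding is_filter_def by blast
  have mul: "x \<otimes> y \<in> F" if "x \<in> F" "y \<in> F" for x y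
    using F that unfolding is_filter_def by blast
  have me: "x \<sqinter> \<one> \<in> F" if "x \<in> F" for x using F that unfolding is_filter_def by blast
  have mt: "z \<in> F" if "p \<in> F" "q \<in> F" "z \<in> S" "p \<sqinter> q \<sqsubseteq> z" for p q z
  proof -
    have pS: "p \<in> S" "q \<in> S" using FS that by auto
    have "(p \<sqinter> \<one>) \<otimes> (q \<sqinter> \<one>) \<sqsubseteq> p \<otimes> \<one>" "(p \<sqinter> \<one>) \<otimes> (q \<sqinter> \<one>) \<sqsubseteq> \<one> \<otimes> q"
      using pS by (intro mult_mono; simp)+
    then have "(p \<sqinter> \<one>) \<otimes> (q \<sqinter> \<one>) \<sqsubseteq> p \<sqinter> q" using pS by (intro meet_greatest) auto
    then have "(p \<sqinter> \<one>) \<otimes> (q \<sqinter> \<one>) \<sqsubseteq> z" by (rule le_trans) (use pS that in auto)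
    then show ?thesis using up[OF mul[OF me me]] that by blast
  qed
  \<comment> \<open>Elements with the same lower bounds are equal, so identities between residuals
    can be checked through residuation.\<close>
  have eqI: "x = y" if "x \<in> S" "y \<in> S" "\<And>w. w \<in> S \<Longrightarrow> w \<sqsubseteq> x \<longleftrightarrow> w \<sqsubseteq> y" for x y
    using that by (meson le_antisym le_refl)
  show ?thesis
  proof
    show "\<not> (a \<rightharpoonup> b) \<in> F" using F by blast
    show "ul_preorder A (\<lambda>x y. x \<rightharpoonup> y \<in> F)"
    proof unfold_locales
      fix x y assume "x \<in> S" "y \<in> S" "x \<sqsubseteq> y"
      then show "x \<rightharpoonup> y \<in> F" using up[OF e, of "x \<rightharpoonup> y"] e_le_imp by auto
    next
      fix x y assume "x \<in> S" "y \<in> S"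
      then show "x \<rightharpoonup> y \<in> F \<or> y \<rightharpoonup> x \<in> F" using tot by blast
    next
      fix x y z assume S: "x \<in> S" "y \<in> S" "z \<in> S" and F: "x \<rightharpoonup> y \<in> F" "y \<rightharpoonup> z \<in> F"
      have "x \<otimes> (x \<rightharpoonup> y) \<otimes> (y \<rightharpoonup> z) \<sqsubseteq> y \<otimes> (y \<rightharpoonup> z)" using S imp_mp by (intro mult_mono) auto
      then have "x \<otimes> (x \<rightharpoonup> y) \<otimes> (y \<rightharpoonup> z) \<sqsubseteq> z" by (rule le_trans) (use S imp_mp in auto)
      then have "(x \<rightharpoonup> y) \<otimes> (y \<rightharpoonup> z) \<sqsubseteq> x \<rightharpoonup> z" using S by (simp flip: residuation add: mult_assoc)
      then show "x \<rightharpoonup> z \<in> F" using up[OF mul[OF F]] S by auto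
    next
      fix x y z assume S: "x \<in> S" "y \<in> S" "z \<in> S"
      have "x \<otimes> y \<rightharpoonup> z = y \<rightharpoonup> x \<rightharpoonup> z"
        by (rule eqI) (use S in \<open>auto simp flip: residuation simp: mult_assoc\<close>)
      then show "x \<otimes> y \<rightharpoonup> z \<in> F \<longleftrightarrow> y \<rightharpoonup> x \<rightharpoonup> z \<in> F" by simp
    next
      fix x y z assume S: "x \<in> S" "y \<in> S" "z \<in> S"
      have iff: "w \<sqsubseteq> z \<rightharpoonup> x \<sqinter> y \<longleftrightarrow> w \<sqsubseteq> z \<rightharpoonup> x \<and> w \<sqsubseteq> z \<rightharpoonup> y" if "w \<in> S" for w
        using S that by (auto simp flip: residuation intro: meet_greatest
            dest: le_trans[of "z \<otimes> w" "x \<sqinter> y" x] le_trans[of "z \<otimes> w" "x \<sqinter> y" y])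
      have "(z \<rightharpoonup> x \<sqinter> y) \<sqsubseteq> z \<rightharpoonup> x" "(z \<rightharpoonup> x \<sqinter> y) \<sqsubseteq> z \<rightharpoonup> y"
        "(z \<rightharpoonup> x) \<sqinter> (z \<rightharpoonup> y) \<sqsubseteq> z \<rightharpoonup> x \<sqinter> y"
        using S iff[of "z \<rightharpoonup> x \<sqinter> y"] iff[of "(z \<rightharpoonup> x) \<sqinter> (z \<rightharpoonup> y)"] by auto
      then show "z \<rightharpoonup> x \<sqinter> y \<in> F \<longleftrightarrow> z \<rightharpoonup> x \<in> F \<and> z \<rightharpoonup> y \<in> F"
        using up[of "z \<rightharpoonup> x \<sqinter> y"] mt[of "z \<rightharpoonup> x" "z \<rightharpoonup> y"] S by (meson closed(4) closed(1) closed(2))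
    next
      fix x y z assume S: "x \<in> S" "y \<in> S" "z \<in> S"
      have iff: "w \<sqsubseteq> x \<squnion> y \<rightharpoonup> z \<longleftrightarrow> w \<sqsubseteq> x \<rightharpoonup> z \<and> w \<sqsubseteq> y \<rightharpoonup> z" if w: "w \<in> S" for w
      proof -
        have "x \<squnion> y \<sqsubseteq> w \<rightharpoonup> z \<longleftrightarrow> x \<sqsubseteq> w \<rightharpoonup> z \<and> y \<sqsubseteq> w \<rightharpoonup> z"
          using S w join_least[of x "w \<rightharpoonup> z" y] le_trans[OF join_ge1, of x y "w \<rightharpoonup> z"]
            le_trans[OF join_ge2, of x y "w \<rightharpoonup> z"] by auto
        then show ?thesis using S w by (auto simp flip: residuation simp: mult_comm[of w])
      qed
      have "(x \<squnion> y \<rightharpoonup> z) \<sqsubseteq> x \<rightharpoonup> z" "(x \<squnion> y \<rightharpoonup> z) \<sqsubseteq> y \<rightharpoonup> z"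
        "(x \<rightharpoonup> z) \<sqinter> (y \<rightharpoonup> z) \<sqsubseteq> x \<squnion> y \<rightharpoonup> z"
        using S iff[of "x \<squnion> y \<rightharpoonup> z"] iff[of "(x \<rightharpoonup> z) \<sqinter> (y \<rightharpoonup> z)"] by auto
      then show "x \<squnion> y \<rightharpoonup> z \<in> F \<longleftrightarrow> x \<rightharpoonup> z \<in> F \<and> y \<rightharpoonup> z \<in> F"
        using up[of "x \<squnion> y \<rightharpoonup> z"] mt[of "x \<rightharpoonup> z" "y \<rightharpoonup> z"] S by (meson closed(4) closed(1) closed(2))
    qed
  qed
qed

section \<open>Chains of sets as UL-algebras\<close>

text \<open>Semilinearity is automatic on a chain: the union of \<open>X\<close> and
  \<open>Y\<close> is one of them, so one of the two residuals contains the unit. \<open>lam\<close>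
  sends such an element to the unit, and all its values are contained in the unit.\<close>

lemma set_chain_UL_alg:
  fixes C :: "'a set ul_alg"
  assumes ops: "meet C = (\<inter>)" "join C = (\<union>)"
    and chain: "\<And>X Y. X \<in> carrier C \<Longrightarrow> Y \<in> carrier C \<Longrightarrow> X \<subseteq> Y \<or> Y \<subseteq> X"
    and mult_closed: "\<And>X Y. X \<in> carrier C \<Longrightarrow> Y \<in> carrier C \<Longrightarrow> mult C X Y \<in> carrier C"
    and imp_closed: "\<And>X Y. X \<in> carrier C \<Longrightarrow> Y \<in> carrier C \<Longrightarrow> imp C X Y \<in> carrier C"
    and constants: "unit_e C \<in> carrier C" "const_f C \<in> carrier C" "bot_c C \<in> carrier C" "top_c C \<in> carrier C"
    and bounds: "\<And>X. X \<in> carrier C \<Longrightarrow> bot_c C \<subseteq> X" "\<And>X. X \<in> carrier C \<Longrightarrow> X \<subseteq> top_c C"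
    and assoc: "\<And>X Y Z. X \<in> carrier C \<Longrightarrow> Y \<in> carrier C \<Longrightarrow> Z \<in> carrier C \<Longrightarrow>
      mult C X (mult C Y Z) = mult C (mult C X Y) Z"
    and comm: "\<And>X Y. X \<in> carrier C \<Longrightarrow> Y \<in> carrier C \<Longrightarrow> mult C X Y = mult C Y X"
    and unit: "\<And>X. X \<in> carrier C \<Longrightarrow> mult C (unit_e C) X = X"
    and resid: "\<And>X Y Z. X \<in> carrier C \<Longrightarrow> Y \<in> carrier C \<Longrightarrow> Z \<in> carrier C \<Longrightarrow>
      mult C X Y \<subseteq> Z \<longleftrightarrow> Y \<subseteq> imp C X Z"
  shows "UL_alg C"
proof -
  have leq: "leq C X Y \<longleftrightarrow> X \<subseteq> Y" for X Y by (auto simp: leq_def ops)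
  have closed: "X \<inter> Y \<in> carrier C \<and> X \<union> Y \<in> carrier C" if "X \<in> carrier C" "Y \<in> carrier C" for X Y
    using chain[OF that] that by (auto simp: Int_absorb1 Int_absorb2 Un_absorb1 Un_absorb2)
  have lam1: "lam C U X = unit_e C"
    if "unit_e C \<subseteq> X" "X \<in> carrier C" "U \<in> carrier C" for U X
  proof -
    have "X \<subseteq> imp C U (mult C U X)"
      using that mult_closed by (simp flip: resid)
    then have "unit_e C \<subseteq> imp C U (mult C X U)" using that comm by auto
    then show ?thesis unfolding lam_def ops by blast
  qed
  have lam2: "lam C U X \<subseteq> unit_e C" for U X
    unfolding lam_def ops by blast
  have e_imp: "unit_e C \<subseteq> imp C X Y" if "X \<in> carrier C" "Y \<in> carrier C" "X \<subseteq> Y" for X Y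
    using that constants comm[of X "unit_e C"] unit by (simp flip: resid)
  have semi: "lam C U (imp C (X \<union> Y) X) \<union> lam C V (imp C (X \<union> Y) Y) = unit_e C"
    if X: "X \<in> carrier C" "Y \<in> carrier C" "U \<in> carrier C" "V \<in> carrier C" for X Y U V
  proof (cases "X \<subseteq> Y")
    case True
    then have "lam C V (imp C (X \<union> Y) Y) = unit_e C"
      using X closed by (intro lam1 e_imp imp_closed) auto
    then show ?thesis using lam2 by auto
  next
    case False
    then have "lam C U (imp C (X \<union> Y) X) = unit_e C"
      using X closed chain[of X Y] by (intro lam1 e_imp imp_closed) auto
    then show ?thesis using lam2 by auto
  qed
  show ?thesis unfolding UL_alg_def Let_def leq ops
  proof (intro conjI ballI)
    fix X Y assume "X \<in> carrier C" "Y \<in> carrier C"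
    then show "X \<inter> Y \<in> carrier C" "X \<union> Y \<in> carrier C" using closed by blast+
  next
    fix X Y Z assume "X \<in> carrier C" "Y \<in> carrier C" "Z \<in> carrier C"
    then show "(mult C X Y \<subseteq> Z) = (Y \<subseteq> imp C X Z)"
      "mult C X (mult C Y Z) = mult C (mult C X Y) Z"
      by (rule resid assoc)+
  next
    fix X Y assume "X \<in> carrier C" "Y \<in> carrier C"
    then show "mult C X Y = mult C Y X" by (rule comm)
  next
    fix X assume "X \<in> carrier C"
    then show "mult C (unit_e C) X = X" by (rule unit)
  qed (simp_all add: mult_closed imp_closed constants bounds semi Un_assoc Int_assoc Un_commute Int_commute Un_Int_distrib, blast+)
qed

section \<open>Subdirect products\<close>

text \<open>\<open>D\<close> is described only by a separating family of homomorphisms, so its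
  elements may be mere codes of tuples. Equations, and residuation through \<open>leq_iff\<close>,
  transfer coordinatewise.\<close>

locale subdirect =
  fixes D :: "'d ul_alg" and I :: "'i set" and C :: "'i \<Rightarrow> 'c ul_alg" and p :: "'i \<Rightarrow> 'd \<Rightarrow> 'c"
  assumes closed [simp, intro]:
    "\<And>x y. x \<in> carrier D \<Longrightarrow> y \<in> carrier D \<Longrightarrow> meet D x y \<in> carrier D"
    "\<And>x y. x \<in> carrier D \<Longrightarrow> y \<in> carrier D \<Longrightarrow> join D x y \<in> carrier D"
    "\<And>x y. x \<in> carrier D \<Longrightarrow> y \<in> carrier D \<Longrightarrow> mult D x y \<in> carrier D"
    "\<And>x y. x \<in> carrier D \<Longrightarrow> y \<in> carrier D \<Longrightarrow> imp D x y \<in> carrier D"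
    "unit_e D \<in> carrier D" "const_f D \<in> carrier D" "bot_c D \<in> carrier D" "top_c D \<in> carrier D"
  and proj [simp]: "\<And>i x. i \<in> I \<Longrightarrow> x \<in> carrier D \<Longrightarrow> p i x \<in> carrier (C i)"
  and hom [simp]:
    "\<And>i x y. i \<in> I \<Longrightarrow> x \<in> carrier D \<Longrightarrow> y \<in> carrier D \<Longrightarrow> p i (meet D x y) = meet (C i) (p i x) (p i y)"
    "\<And>i x y. i \<in> I \<Longrightarrow> x \<in> carrier D \<Longrightarrow> y \<in> carrier D \<Longrightarrow> p i (join D x y) = join (C i) (p i x) (p i y)"
    "\<And>i x y. i \<in> I \<Longrightarrow> x \<in> carrier D \<Longrightarrow> y \<in> carrier D \<Longrightarrow> p i (mult D x y) = mult (C i) (p i x) (p i y)"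
    "\<And>i x y. i \<in> I \<Longrightarrow> x \<in> carrier D \<Longrightarrow> y \<in> carrier D \<Longrightarrow> p i (imp D x y) = imp (C i) (p i x) (p i y)"
    "\<And>i. i \<in> I \<Longrightarrow> p i (unit_e D) = unit_e (C i)" "\<And>i. i \<in> I \<Longrightarrow> p i (const_f D) = const_f (C i)"
    "\<And>i. i \<in> I \<Longrightarrow> p i (bot_c D) = bot_c (C i)" "\<And>i. i \<in> I \<Longrightarrow> p i (top_c D) = top_c (C i)"
  and sep: "\<And>x y. x \<in> carrier D \<Longrightarrow> y \<in> carrier D \<Longrightarrow> (\<And>i. i \<in> I \<Longrightarrow> p i x = p i y) \<Longrightarrow> x = y"
begin

lemma leq_iff:
  "x \<in> carrier D \<Longrightarrow> y \<in> carrier D \<Longrightarrow> leq D x y \<longleftrightarrow> (\<forall>i\<in>I. leq (C i) (p i x) (p i y))"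
  unfolding leq_def by (metis closed(1) hom(1) sep)

lemma lam_closed [simp]: "x \<in> carrier D \<Longrightarrow> y \<in> carrier D \<Longrightarrow> lam D x y \<in> carrier D"
  and lam_hom [simp]: "i \<in> I \<Longrightarrow> x \<in> carrier D \<Longrightarrow> y \<in> carrier D \<Longrightarrow> p i (lam D x y) = lam (C i) (p i x) (p i y)"
  by (simp_all add: lam_def)

lemma UL_alg:
  assumes "\<And>i. i \<in> I \<Longrightarrow> UL_alg (C i)"
  shows "UL_alg D"
proof -
  have U: "ul (C i)" if "i \<in> I" for i using assms that by unfold_locales
  note ax = ul.meet_assoc[OF U] ul.join_assoc[OF U] ul.absorb1[OF U] ul.absorb2[OF U] ul.meet_idem[OF U]
    ul.join_idem[OF U] ul.bot_le[OF U] ul.le_top[OF U] ul.mult_assoc[OF U] ul.unit_left[OF U] ul.semilinear[OF U]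
  show ?thesis unfolding UL_alg_def Let_def
  proof (intro conjI ballI)
    fix x y assume xy: "x \<in> carrier D" "y \<in> carrier D"
    show "meet D x y = meet D y x" using xy by (intro sep) (simp_all add: ul.meet_comm[OF U])
    show "join D x y = join D y x" using xy by (intro sep) (simp_all add: ul.join_comm[OF U])
    show "mult D x y = mult D y x" using xy by (intro sep) (simp_all add: ul.mult_comm[OF U])
    show "leq D (mult D x y) z = leq D y (imp D x z)" if "z \<in> carrier D" for z
      using xy that by (simp add: leq_iff ul.residuation[OF U])
  next
    fix x y u v assume xy: "x \<in> carrier D" "y \<in> carrier D" "u \<in> carrier D" "v \<in> carrier D"
    show "join D (lam D u (imp D (join D x y) x)) (lam D v (imp D (join D x y) y)) = unit_e D"
      using xy by (intro sep) (simp_all add: ul.semilinear[OF U])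
  qed (auto simp: leq_iff ax intro!: sep)
qed

lemma UL_omega_alg:
  assumes "\<And>i. i \<in> I \<Longrightarrow> UL_omega_alg (C i)"
  shows "UL_omega_alg D"
  unfolding UL_omega_alg_def
proof (intro conjI ballI)
  show "UL_alg D" using assms UL_alg by (auto simp: UL_omega_alg_def)
  fix x assume x: "x \<in> carrier D"
  show "imp D x (unit_e D) = imp D (mult D x x) (unit_e D)"
    using assms x by (intro sep) (auto simp: UL_omega_alg_def)
qed

lemma IUL_omega_alg:
  assumes "\<And>i. i \<in> I \<Longrightarrow> IUL_omega_alg (C i)"
  shows "IUL_omega_alg D"
  unfolding IUL_omega_alg_def
proof (intro conjI ballI)
  show "UL_omega_alg D" using assms UL_omega_alg by (auto simp: IUL_omega_alg_def)
  fix x assume x: "x \<in> carrier D"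
  show "neg D (neg D x) = x"
    using assms x by (intro sep) (auto simp: IUL_omega_alg_def neg_def)
qed

end

section \<open>Thinning sequences of exponents\<close>

text \<open>A sequence of natural numbers takes some value infinitely often, or each term is
  followed by a larger one. Being constant or strictly increasing persists under subsequences, so
  the finitely many coordinates are treated one after the other.\<close>

lemma const_or_strict_mono_subseq:
  fixes s :: "nat \<Rightarrow> 'k \<Rightarrow> nat"
  assumes "finite K"
  obtains r :: "nat \<Rightarrow> nat" where "strict_mono r"
    "\<And>k. k \<in> K \<Longrightarrow> (\<forall>i j. s (r i) k = s (r j) k) \<or> strict_mono (\<lambda>i. s (r i) k)"
proof -
  have one: "\<exists>r::nat\<Rightarrow>nat. strict_mono r \<and> ((\<forall>i j. f (r i) = f (r j)) \<or> strict_mono (\<lambda>i. f (r i)))"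
    for f :: "nat \<Rightarrow> nat"
  proof (cases "\<exists>v. infinite {i. f i = v}")
    case True
    then obtain v where v: "infinite {i. f i = v}" by blast
    have "f (enumerate {i. f i = v} n) = v" for n using enumerate_in_set[OF v, of n] by simp
    then show ?thesis using strict_mono_enumerate[OF v] by metis
  next
    case False
    have "\<exists>m>n. f m > f n" for n
    proof -
      \<comment> \<open>Only finitely many indices have a value at most \<open>f n\<close>, so some
        index beyond \<open>n\<close> has a larger one.\<close>
      have "finite (\<Union>v\<le>f n. {i. f i = v})" using False by blast
      then have "finite ({..n} \<union> (\<Union>v\<le>f n. {i. f i = v}))" by blast
      then obtain m where "m \<notin> {..n} \<union> (\<Union>v\<le>f n. {i. f i = v})"
        using infinite_UNIV_nat by (meson ex_new_if_finite)
      then show ?thesis by (intro exI[of _ m]) auto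
    qed
    then obtain r :: "nat \<Rightarrow> nat" where "\<And>n. r n < r (Suc n) \<and> f (r n) < f (r (Suc n))"
      using dependent_nat_choice[of "\<lambda>_ _. True" "\<lambda>_ n m. n < m \<and> f n < f m"] by blast
    then show ?thesis by (intro exI[of _ r]) (simp add: strict_mono_Suc_iff)
  qed
  have "\<exists>r::nat\<Rightarrow>nat. strict_mono r \<and>
    (\<forall>k\<in>K. (\<forall>i j. s (r i) k = s (r j) k) \<or> strict_mono (\<lambda>i. s (r i) k))"
    using assms
  proof (induction K)
    case empty
    then show ?case by (intro exI[of _ id]) (simp add: strict_mono_def)
  next
    case (insert k K)
    then obtain r :: "nat \<Rightarrow> nat" where r: "strict_mono r"
      "\<forall>k\<in>K. (\<forall>i j. s (r i) k = s (r j) k) \<or> strict_mono (\<lambda>i. s (r i) k)" by blast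
    obtain q :: "nat \<Rightarrow> nat" where q: "strict_mono q"
      "(\<forall>i j. s (r (q i)) k = s (r (q j)) k) \<or> strict_mono (\<lambda>i. s (r (q i)) k)"
      using one[of "\<lambda>i. s (r i) k"] by blast
    have "strict_mono (\<lambda>i. r (q i))" using r(1) q(1) by (simp add: strict_mono_def)
    moreover have "strict_mono (\<lambda>i. s (r (q i)) k')" if "strict_mono (\<lambda>i. s (r i) k')" for k'
      using that q(1) by (simp add: strict_mono_def)
    ultimately show ?case using r(2) q(2) by (intro exI[of _ "\<lambda>i. r (q i)"]) fastforce
  qed
  then show ?thesis using that by blast
qed

section \<open>Monomials in the generators\<close>

context ul
begin

lemma mult_left_comm: "x \<in> S \<Longrightarrow> y \<in> S \<Longrightarrow> z \<in> S \<Longrightarrow> x \<otimes> (y \<otimes> z) = y \<otimes> (x \<otimes> z)"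
  using mult_comm[of x y] by (simp add: mult_assoc)

lemmas mult_ac = mult_assoc[symmetric] mult_comm mult_left_comm

primrec pw :: "'a \<Rightarrow> nat \<Rightarrow> 'a" where
  "pw b 0 = \<one>"
| "pw b (Suc n) = b \<otimes> pw b n"

text \<open>The monomial with exponent vector \<open>v\<close>, of which only the values on
  \<open>set bs\<close> matter. For distinct \<open>bs\<close> in the algebra, the range of
  \<open>ev bs\<close> is the submonoid generated by \<open>set bs\<close>.\<close>

primrec ev :: "'a list \<Rightarrow> ('a \<Rightarrow> nat) \<Rightarrow> 'a" where
  "ev [] v = \<one>"
| "ev (b # bs) v = pw b (v b) \<otimes> ev bs v"

lemma pw_closed [simp, intro]: "b \<in> S \<Longrightarrow> pw b n \<in> S"
  by (induction n) auto

lemma ev_closed [simp, intro]: "set bs \<subseteq> S \<Longrightarrow> ev bs v \<in> S"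
  by (induction bs) auto

lemma pw_add: "b \<in> S \<Longrightarrow> pw b (m + n) = pw b m \<otimes> pw b n"
  by (induction m) (simp_all add: mult_assoc)

lemma ev_add: "set bs \<subseteq> S \<Longrightarrow> ev bs (\<lambda>b. v b + w b) = ev bs v \<otimes> ev bs w"
  by (induction bs) (simp_all add: pw_add mult_ac)

lemma ev_cong: "(\<And>b. b \<in> set bs \<Longrightarrow> v b = w b) \<Longrightarrow> ev bs v = ev bs w"
  by (induction bs) auto

lemma ev_zero: "ev bs (\<lambda>_. 0) = \<one>"
  by (induction bs) auto

lemma ev_single:
  "set bs \<subseteq> S \<Longrightarrow> distinct bs \<Longrightarrow> b \<in> set bs \<Longrightarrow> ev bs (\<lambda>x. if x = b then 1 else 0) = b"
proof (induction bs)
  case (Cons a bs)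
  show ?case
  proof (cases "a = b")
    case True
    then have "ev bs (\<lambda>x. if x = b then 1 else 0) = ev bs (\<lambda>_. 0)"
      using Cons by (intro ev_cong) auto
    then show ?thesis using True Cons by (simp add: ev_zero)
  next
    case False
    then show ?thesis using Cons unit_left[of b] by auto
  qed
qed simp

end

section \<open>The omega axiom and steady exponent sequences\<close>

locale ul_omega_preorder = ul_preorder +
  assumes imp_square: "x \<in> S \<Longrightarrow> x \<rightharpoonup> \<one> = x \<otimes> x \<rightharpoonup> \<one>"
begin

lemma mono:
  assumes "x \<preceq> y" "x \<in> S" "y \<in> S" "z \<in> S"
  shows "z \<otimes> x \<preceq> z \<otimes> y"
proof -
  have "y \<preceq> z \<rightharpoonup> z \<otimes> y" using assms by (intro ext) (simp_all flip: residuation)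
  then have "x \<preceq> z \<rightharpoonup> z \<otimes> y" using assms by (intro trans[OF _ _ _ assms(1)]) auto
  then show ?thesis using assms by (simp add: resid)
qed

text \<open>The axiom in residuated form; the parameter \<open>y\<close> absorbs the remaining
  factors of a product.\<close>

lemma square_le_one: "x \<in> S \<Longrightarrow> y \<in> S \<Longrightarrow> x \<otimes> (x \<otimes> y) \<preceq> \<one> \<longleftrightarrow> x \<otimes> y \<preceq> \<one>"
  by (simp add: mult_assoc resid flip: imp_square)

lemma pw_le_one: "b \<in> S \<Longrightarrow> y \<in> S \<Longrightarrow> 0 < n \<Longrightarrow> pw b n \<otimes> y \<preceq> \<one> \<longleftrightarrow> b \<otimes> y \<preceq> \<one>"
proof (induction n arbitrary: y)
  case (Suc n)
  have "pw b (Suc n) \<otimes> y = pw b n \<otimes> (b \<otimes> y)" using Suc.prems by (simp add: mult_ac)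
  then show ?case using Suc square_le_one[of b y] by (cases n) auto
qed simp

text \<open>By \<open>pw_le_one\<close> a positive exponent may be exchanged for any other positive
  one. This is done generator by generator, with the remaining factors collected in
  \<open>y\<close>.\<close>

lemma ev_le_one_cong:
  assumes "set bs \<subseteq> S" "\<And>b. b \<in> set bs \<Longrightarrow> v b = 0 \<longleftrightarrow> w b = 0" "y \<in> S"
  shows "ev bs v \<otimes> y \<preceq> \<one> \<longleftrightarrow> ev bs w \<otimes> y \<preceq> \<one>"
  using assms
proof (induction bs arbitrary: y)
  case (Cons b bs)
  have "ev (b # bs) v \<otimes> y \<preceq> \<one> \<longleftrightarrow> ev bs v \<otimes> (pw b (v b) \<otimes> y) \<preceq> \<one>"
    using Cons.prems by (simp add: mult_ac)
  also have "\<dots> \<longleftrightarrow> ev bs w \<otimes> (pw b (v b) \<otimes> y) \<preceq> \<one>"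
    using Cons by simp
  also have "\<dots> \<longleftrightarrow> pw b (v b) \<otimes> (ev bs w \<otimes> y) \<preceq> \<one>"
    using Cons.prems by (simp add: mult_left_comm)
  also have "\<dots> \<longleftrightarrow> pw b (w b) \<otimes> (ev bs w \<otimes> y) \<preceq> \<one>"
    using Cons.prems(2)[of b] Cons.prems(1,3) by (cases "v b = 0") (simp_all add: pw_le_one)
  finally show ?case using Cons.prems by (simp add: mult_assoc)
qed simp

text \<open>The outcome of thinning: the generators whose exponent differs between
  \<open>m i\<close> and \<open>m j\<close> are the same for all \<open>i < j\<close>.\<close>

definition steady :: "'a list \<Rightarrow> (nat \<Rightarrow> 'a \<Rightarrow> nat) \<Rightarrow> bool" where
  "steady bs m \<longleftrightarrow> (\<forall>b\<in>set bs. (\<forall>i j. m i b = m j b) \<or> strict_mono (\<lambda>i. m i b))"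

text \<open>Exponents never decrease along a steady sequence, so truncated subtraction is exact and
  the quotient of two terms is again a monomial.\<close>

lemma steady_split:
  assumes "set bs \<subseteq> S" "steady bs m" "i < j"
  shows "ev bs (m j) = ev bs (m i) \<otimes> ev bs (\<lambda>b. m j b - m i b)"
proof -
  have "m i b \<le> m j b" if "b \<in> set bs" for b
    using assms(2,3) that unfolding steady_def by (metis strict_mono_less order.refl order.strict_implies_order)
  then have "ev bs (m j) = ev bs (\<lambda>b. m i b + (m j b - m i b))" by (intro ev_cong) simp
  then show ?thesis using ev_add[OF assms(1)] by simp
qed

text \<open>The exponent difference vanishes exactly at the constant generators, whatever the
  indices, so \<open>ev_le_one_cong\<close> applies.\<close>

lemma steady_sign:
  assumes "set bs \<subseteq> S" "steady bs m" "i < j" "i' < j'" "y \<in> S"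
  shows "ev bs (\<lambda>b. m j b - m i b) \<otimes> y \<preceq> \<one> \<longleftrightarrow> ev bs (\<lambda>b. m j' b - m i' b) \<otimes> y \<preceq> \<one>"
proof (rule ev_le_one_cong)
  fix b assume "b \<in> set bs"
  then consider "\<forall>i j. m i b = m j b" | "strict_mono (\<lambda>i. m i b)" using assms(2) unfolding steady_def by blast
  then show "m j b - m i b = 0 \<longleftrightarrow> m j' b - m i' b = 0"
  proof cases
    case 2
    then have "m i b < m j b" "m i' b < m j' b" using assms by (auto simp: strict_mono_def)
    then show ?thesis by simp
  qed (metis diff_self_eq_0)
qed (use assms in auto)

text \<open>The factor by which a product of two steady sequences changes has constant support, so
  the products all move in the same direction.\<close>

lemma steady_dichotomy:
  assumes bs: "set bs \<subseteq> S" and st: "steady bs m" "steady bs x"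
  shows "(\<forall>k l i j. i < k \<longrightarrow> j < l \<longrightarrow> ev bs (m k) \<otimes> ev bs (x l) \<preceq> ev bs (m i) \<otimes> ev bs (x j))
       \<or> (\<forall>k l i j. i < k \<longrightarrow> j < l \<longrightarrow> ev bs (m i) \<otimes> ev bs (x j) \<preceq> ev bs (m k) \<otimes> ev bs (x l))"
proof -
  let ?d = "\<lambda>m i k. ev bs (\<lambda>b. m k b - m i b)"
  \<comment> \<open>Each quotient is replaced by the one for the indices 0 and 1. The factors are
    swapped in between because \<open>steady_sign\<close> acts on the left one.\<close>
  have const: "?d m i k \<otimes> ?d x j l \<preceq> \<one> \<longleftrightarrow> ?d m 0 1 \<otimes> ?d x 0 1 \<preceq> \<one>" if "i < k" "j < l" for i j k l
  proof -
    have "?d m i k \<otimes> ?d x j l \<preceq> \<one> \<longleftrightarrow> ?d m 0 1 \<otimes> ?d x j l \<preceq> \<one>"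
      using bs that by (intro steady_sign st) auto
    also have "\<dots> \<longleftrightarrow> ?d x j l \<otimes> ?d m 0 1 \<preceq> \<one>" using bs by (simp add: mult_comm)
    also have "\<dots> \<longleftrightarrow> ?d x 0 1 \<otimes> ?d m 0 1 \<preceq> \<one>"
      using bs that by (intro steady_sign st) auto
    finally show ?thesis using bs by (simp add: mult_comm)
  qed
  have split: "ev bs (m k) \<otimes> ev bs (x l) = (ev bs (m i) \<otimes> ev bs (x j)) \<otimes> (?d m i k \<otimes> ?d x j l)"
    if "i < k" "j < l" for i j k l
    using steady_split[OF bs st(1) that(1)] steady_split[OF bs st(2) that(2)] bs by (simp add: mult_ac)
  show ?thesis
  proof (cases "?d m 0 1 \<otimes> ?d x 0 1 \<preceq> \<one>")
    case True
    have "ev bs (m k) \<otimes> ev bs (x l) \<preceq> ev bs (m i) \<otimes> ev bs (x j)" if "i < k" "j < l" for i j k l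
      using mono[of "?d m i k \<otimes> ?d x j l" \<one> "ev bs (m i) \<otimes> ev bs (x j)"] const[OF that] True bs split[OF that]
      by simp
    then show ?thesis by blast
  next
    case False
    have "ev bs (m i) \<otimes> ev bs (x j) \<preceq> ev bs (m k) \<otimes> ev bs (x l)" if "i < k" "j < l" for i j k l
    proof -
      have "\<one> \<preceq> ?d m i k \<otimes> ?d x j l"
        using const[OF that] False bs total[of \<one> "?d m i k \<otimes> ?d x j l"] by auto
      then show ?thesis
        using mono[of \<one> "?d m i k \<otimes> ?d x j l" "ev bs (m i) \<otimes> ev bs (x j)"] bs split[OF that] by simp
    qed
    then show ?thesis by blast
  qed
qed

section \<open>Finiteness of the family of cuts\<close>

text \<open>When both indices grow, the products of thinned sequences move in one direction, so
  lying below \<open>b\<close> is inherited either upwards or downwards. Each ladder violates both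
  among the indices 0, 1 and 2.\<close>

lemma no_ladder:
  fixes m x :: "nat \<Rightarrow> 'a \<Rightarrow> nat"
  assumes bs: "set bs \<subseteq> S" and b: "b \<in> S"
  shows "\<not> (\<forall>l i. ev bs (m l) \<otimes> ev bs (x i) \<preceq> b \<longleftrightarrow> i < l)"
    and "\<not> (\<forall>l i. ev bs (m l) \<otimes> ev bs (x i) \<preceq> b \<longleftrightarrow> l \<le> i)"
proof -
  \<comment> \<open>Both sequences are thinned along the same indices, with a sum type for the
    coordinates. As \<open>r\<close> is strictly increasing, comparisons between indices, and hence
    the ladder pattern, survive.\<close>
  obtain r :: "nat \<Rightarrow> nat" where r: "strict_mono r" and cs:
    "\<And>k. k \<in> Inl ` set bs \<union> Inr ` set bs \<Longrightarrow> (\<forall>i j. case_sum (m (r i)) (x (r i)) k = case_sum (m (r j)) (x (r j)) k)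
      \<or> strict_mono (\<lambda>i. case_sum (m (r i)) (x (r i)) k)"
    using const_or_strict_mono_subseq[of "Inl ` set bs \<union> Inr ` set bs" "\<lambda>i. case_sum (m i) (x i)"] by blast
  have st: "steady bs (\<lambda>i. m (r i))" "steady bs (\<lambda>i. x (r i))"
    unfolding steady_def using cs[OF UnI1, OF imageI] cs[OF UnI2, OF imageI] by auto
  define P where "P = (\<lambda>l i. ev bs (m (r l)) \<otimes> ev bs (x (r i)) \<preceq> b)"
  have mono_P: "P k l" if "ev bs (m (r k)) \<otimes> ev bs (x (r l)) \<preceq> ev bs (m (r i)) \<otimes> ev bs (x (r j))" "P i j" for i j k l
    unfolding P_def by (rule trans[OF _ _ b that(1) that(2)[unfolded P_def]]) (use bs in auto)
  have "(\<forall>k l i j. i < k \<longrightarrow> j < l \<longrightarrow> P i j \<longrightarrow> P k l) \<or> (\<forall>k l i j. i < k \<longrightarrow> j < l \<longrightarrow> P k l \<longrightarrow> P i j)"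
    using steady_dichotomy[OF bs st] mono_P by blast
  moreover have "(0::nat) < 1" "(0::nat) < 2" "(1::nat) < 2" by simp_all
  \<comment> \<open>The first ladder violates \<open>P 1 0 \<longrightarrow> P 2 2\<close> and
    \<open>P 2 1 \<longrightarrow> P 0 0\<close>, the second ladder the other two
    implications.\<close>
  ultimately have D: "(P 1 0 \<longrightarrow> P 2 2) \<and> (P 0 0 \<longrightarrow> P 2 1) \<or> (P 2 1 \<longrightarrow> P 0 0) \<and> (P 2 2 \<longrightarrow> P 1 0)"
    by blast
  show "\<not> (\<forall>l i. ev bs (m l) \<otimes> ev bs (x i) \<preceq> b \<longleftrightarrow> i < l)"
  proof
    assume "\<forall>l i. ev bs (m l) \<otimes> ev bs (x i) \<preceq> b \<longleftrightarrow> i < l"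
    then have "P l i \<longleftrightarrow> i < l" for l i unfolding P_def using strict_mono_less[OF r] by blast
    then show False using D by auto
  qed
  show "\<not> (\<forall>l i. ev bs (m l) \<otimes> ev bs (x i) \<preceq> b \<longleftrightarrow> l \<le> i)"
  proof
    assume "\<forall>l i. ev bs (m l) \<otimes> ev bs (x i) \<preceq> b \<longleftrightarrow> l \<le> i"
    then have "P l i \<longleftrightarrow> l \<le> i" for l i unfolding P_def using strict_mono_less_eq[OF r] by blast
    then show False using D by auto
  qed
qed

text \<open>The trace on the monomials of the down-set of
  \<open>u \<rightharpoonup> b\<close>.\<close>

definition cut :: "'a list \<Rightarrow> 'a \<Rightarrow> 'a \<Rightarrow> 'a set" where
  "cut bs u b = {x \<in> range (ev bs). u \<otimes> x \<preceq> b}"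

lemma cut_antimono:
  assumes "set bs \<subseteq> S" "u \<in> S" "u' \<in> S" "b \<in> S" "u \<preceq> u'"
  shows "cut bs u' b \<subseteq> cut bs u b"
proof
  fix x assume "x \<in> cut bs u' b"
  then have x: "x \<in> range (ev bs)" "x \<in> S" "u' \<otimes> x \<preceq> b" using assms(1) by (auto simp: cut_def)
  have "u \<otimes> x \<preceq> u' \<otimes> x" using mono[of u u' x] x assms by (simp add: mult_comm)
  then have "u \<otimes> x \<preceq> b" using x assms by (intro trans[of "u \<otimes> x" "u' \<otimes> x" b]) auto
  then show "x \<in> cut bs u b" using x by (simp add: cut_def)
qed

text \<open>Thinning the multipliers of infinitely many cuts gives a strictly monotone sequence of
  cuts. Elements separating consecutive cuts then form a ladder.\<close>

lemma finite_cuts: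
  assumes bs: "set bs \<subseteq> S" and b: "b \<in> S"
  shows "finite (range (\<lambda>v. cut bs (ev bs v) b))"
proof (rule ccontr)
  assume "infinite (range (\<lambda>v. cut bs (ev bs v) b))"
  then obtain f :: "nat \<Rightarrow> 'a set" where f: "inj f" "range f \<subseteq> range (\<lambda>v. cut bs (ev bs v) b)"
    using infinite_countable_subset by blast
  then have "\<forall>i. \<exists>v. f i = cut bs (ev bs v) b" by blast
  then obtain m0 where m0: "\<And>i. f i = cut bs (ev bs (m0 i)) b" by metis
  obtain r :: "nat \<Rightarrow> nat" where r: "strict_mono r"
    and cs: "\<And>k. k \<in> set bs \<Longrightarrow> (\<forall>i j. m0 (r i) k = m0 (r j) k) \<or> strict_mono (\<lambda>i. m0 (r i) k)"
    using const_or_strict_mono_subseq[of "set bs" m0] by blast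
  define m where "m = (\<lambda>i. m0 (r i))"
  define c where "c = (\<lambda>i. cut bs (ev bs (m i)) b)"
  have st: "steady bs m" using cs by (auto simp: steady_def m_def)
  \<comment> \<open>Zero exponents give the constant sequence \<open>\<one>\<close>, so
    \<open>steady_dichotomy\<close> says that the multipliers alone are increasing or
    decreasing.\<close>
  have st0: "steady bs (\<lambda>_ _. 0)" by (simp add: steady_def)
  have inj: "c i \<noteq> c j" if "i \<noteq> j" for i j
    using that f(1) strict_mono_eq[OF r] by (simp add: c_def m_def inj_eq flip: m0)
  have mem: "ev bs x \<in> c l \<longleftrightarrow> ev bs (m l) \<otimes> ev bs x \<preceq> b" for x l by (simp add: c_def cut_def)
  have cr: "c i \<subseteq> range (ev bs)" for i by (auto simp: c_def cut_def)
  consider "\<forall>k i. i < k \<longrightarrow> ev bs (m k) \<preceq> ev bs (m i)" | "\<forall>k i. i < k \<longrightarrow> ev bs (m i) \<preceq> ev bs (m k)"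
    using steady_dichotomy[OF bs st st0] bs by (simp add: ev_zero) (meson lessI)
  then show False
  proof cases
    case 1
    then have sub: "c i \<subseteq> c k" if "i \<le> k" for i k
      using that cut_antimono[OF bs _ _ b] bs unfolding c_def by (cases "i = k") auto
    \<comment> \<open>Decreasing multipliers give increasing cuts. The \<open>i\<close>-th witness
      enters at \<open>Suc i\<close>, hence lies in \<open>c l\<close> exactly for
      \<open>i < l\<close>.\<close>
    have "\<forall>i. \<exists>x. ev bs x \<in> c (Suc i) - c i"
    proof
      fix i
      have "c i \<subset> c (Suc i)" using sub[of i "Suc i"] inj[of i "Suc i"] by auto
      then show "\<exists>x. ev bs x \<in> c (Suc i) - c i" using cr[of "Suc i"] by blast
    qed
    then obtain x where x: "\<And>i. ev bs (x i) \<in> c (Suc i) - c i" by metis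
    have "ev bs (m l) \<otimes> ev bs (x i) \<preceq> b \<longleftrightarrow> i < l" for l i
      using x[of i] sub[of "Suc i" l] sub[of l i] unfolding mem[symmetric] by (cases "i < l") auto
    then show False using no_ladder(1)[OF bs b] by blast
  next
    case 2
    then have sub: "c k \<subseteq> c i" if "i \<le> k" for i k
      using that cut_antimono[OF bs _ _ b] bs unfolding c_def by (cases "i = k") auto
    \<comment> \<open>Now the cuts decrease. The \<open>i\<close>-th witness is lost at
      \<open>Suc i\<close>, hence lies in \<open>c l\<close> exactly for
      \<open>l \<le> i\<close>.\<close>
    have "\<forall>i. \<exists>x. ev bs x \<in> c i - c (Suc i)"
    proof
      fix i
      have "c (Suc i) \<subset> c i" using sub[of i "Suc i"] inj[of i "Suc i"] by auto
      then show "\<exists>x. ev bs x \<in> c i - c (Suc i)" using cr[of i] by blast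
    qed
    then obtain x where x: "\<And>i. ev bs (x i) \<in> c i - c (Suc i)" by metis
    have "ev bs (m l) \<otimes> ev bs (x i) \<preceq> b \<longleftrightarrow> l \<le> i" for l i
      using x[of i] sub[of "Suc i" l] sub[of l i] unfolding mem[symmetric] by (cases "l \<le> i") auto
    then show False using no_ladder(2)[OF bs b] by blast
  qed
qed

end

section \<open>The algebra of cuts\<close>

locale cut_algebra = ul_omega_preorder +
  fixes bs :: "'a list"
  assumes bs: "set bs \<subseteq> S" "distinct bs"
    and constants: "\<one> \<in> set bs" "const_f A \<in> set bs" "bot_c A \<in> set bs" "top_c A \<in> set bs"
begin

definition "M = range (ev bs)"

definition "cuts = {cut bs u b |u b. u \<in> M \<and> b \<in> set bs}"

definition below :: "'a \<Rightarrow> 'a set" where "below b = cut bs \<one> b"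

text \<open>The pointwise product is closed off to the least cut containing it. The intersection is
  itself a cut by \<open>Inter_cuts\<close>.\<close>

definition cmult :: "'a set \<Rightarrow> 'a set \<Rightarrow> 'a set" where
  "cmult X Y = \<Inter>{Z \<in> cuts. \<forall>x\<in>X. \<forall>y\<in>Y. x \<otimes> y \<in> Z}"

definition cimp :: "'a set \<Rightarrow> 'a set \<Rightarrow> 'a set" where
  "cimp X Y = {y \<in> M. \<forall>x\<in>X. x \<otimes> y \<in> Y}"

definition calg :: "'a set ul_alg" where
  "calg = \<lparr>carrier = cuts, meet = (\<inter>), join = (\<union>), mult = cmult, imp = cimp,
     unit_e = below \<one>, const_f = below (const_f A), bot_c = below (bot_c A), top_c = below (top_c A)\<rparr>"

lemma M_closed [simp, intro]: "x \<in> M \<Longrightarrow> y \<in> M \<Longrightarrow> x \<otimes> y \<in> M"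
  unfolding M_def by (auto simp flip: ev_add[OF bs(1)])

lemma cut_eq: "cut bs u b = {x \<in> M. u \<otimes> x \<preceq> b}"
  by (simp add: cut_def M_def)

lemma M_S: "x \<in> M \<Longrightarrow> x \<in> S"
  using bs by (auto simp: M_def)

lemma bs_M: "b \<in> set bs \<Longrightarrow> b \<in> M"
  unfolding M_def using ev_single[OF bs, of b] rangeI[of "ev bs"] by metis

lemma bs_S: "b \<in> set bs \<Longrightarrow> b \<in> S"
  using bs by auto

lemma R_refl [simp]: "x \<in> S \<Longrightarrow> x \<preceq> x"
  by (simp add: ext)

lemma below_eq: "below b = {x \<in> M. x \<preceq> b}"
  using M_S by (auto simp: below_def cut_eq)

lemma below_cuts: "b \<in> set bs \<Longrightarrow> below b \<in> cuts"
  unfolding below_def cuts_def using bs_M constants by blast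

lemma finite_cuts_set: "finite cuts"
proof -
  have "cuts = (\<Union>b\<in>set bs. range (\<lambda>v. cut bs (ev bs v) b))" unfolding cuts_def M_def by blast
  then show ?thesis using finite_cuts[OF bs(1)] bs_S by simp
qed

lemma cutsE:
  assumes "X \<in> cuts"
  obtains u b where "u \<in> M" "u \<in> S" "b \<in> set bs" "b \<in> S" "X = {x \<in> M. u \<otimes> x \<preceq> b}"
  using assms M_S bs_S unfolding cuts_def cut_eq by blast

lemma cuts_M: "X \<in> cuts \<Longrightarrow> x \<in> X \<Longrightarrow> x \<in> M"
  by (auto elim!: cutsE)

lemma down:
  assumes "X \<in> cuts" "x \<in> X" "y \<in> M" "y \<preceq> x"
  shows "y \<in> X"
proof -
  obtain u b where ub: "u \<in> S" "b \<in> S" "X = {x \<in> M. u \<otimes> x \<preceq> b}" using assms(1) by (rule cutsE)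
  have xy: "x \<in> S" "y \<in> S" using assms cuts_M M_S by blast+
  have "u \<otimes> y \<preceq> b"
    using trans[OF _ _ _ mono[OF assms(4)], of u b] assms ub xy by simp
  then show ?thesis using ub assms by simp
qed

text \<open>Cuts are down-sets of a total preorder.\<close>

lemma chain: "X \<in> cuts \<Longrightarrow> Y \<in> cuts \<Longrightarrow> X \<subseteq> Y \<or> Y \<subseteq> X"
  using down total cuts_M M_S by (meson subsetI)

lemma top_eq: "below (top_c A) = M"
  using M_S le_top ext by (auto simp: below_eq)

text \<open>Residuation puts \<open>bot_c A\<close> into every cut, since it lies below each
  \<open>u \<rightharpoonup> b\<close>.\<close>

lemma bot_below: "X \<in> cuts \<Longrightarrow> below (bot_c A) \<subseteq> X"
proof
  fix x assume X: "X \<in> cuts" and x: "x \<in> below (bot_c A)"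
  obtain u b where ub: "u \<in> S" "b \<in> S" "X = {x \<in> M. u \<otimes> x \<preceq> b}" using X by (rule cutsE)
  have "u \<otimes> bot_c A \<preceq> b" using ub by (intro ext) (simp_all add: residuation bot_le)
  then have "bot_c A \<in> X" using ub bs_M constants by simp
  then show "x \<in> X" using down[OF X] x by (simp add: below_eq)
qed

lemma cuts_nonempty: "X \<in> cuts \<Longrightarrow> X \<noteq> {}"
  using bot_below[of X] bs_M[OF constants(3)] by (auto simp: below_eq)

text \<open>A nonempty family in a finite chain has a least member, which is its
  intersection.\<close>

lemma Inter_cuts:
  assumes "\<D> \<subseteq> cuts" "\<D> \<noteq> {}"
  shows "\<Inter>\<D> \<in> cuts"
proof -
  obtain X where "X \<in> \<D>" "\<forall>Y\<in>\<D>. Y \<subseteq> X \<longrightarrow> X = Y"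
    using finite_has_minimal[of \<D>] assms finite_subset[OF _ finite_cuts_set] by metis
  then have "\<Inter>\<D> = X" using chain assms by blast
  then show ?thesis using \<open>X \<in> \<D>\<close> assms by blast
qed

lemma cmult_closed: "X \<in> cuts \<Longrightarrow> Y \<in> cuts \<Longrightarrow> cmult X Y \<in> cuts"
  unfolding cmult_def
proof (rule Inter_cuts)
  assume "X \<in> cuts" "Y \<in> cuts"
  then have "below (top_c A) \<in> {Z \<in> cuts. \<forall>x\<in>X. \<forall>y\<in>Y. x \<otimes> y \<in> Z}"
    using below_cuts[OF constants(4)] cuts_M by (auto simp: top_eq)
  then show "{Z \<in> cuts. \<forall>x\<in>X. \<forall>y\<in>Y. x \<otimes> y \<in> Z} \<noteq> {}" by blast
qed blast

lemma cmult_subset_iff: "Z \<in> cuts \<Longrightarrow> cmult X Y \<subseteq> Z \<longleftrightarrow> (\<forall>x\<in>X. \<forall>y\<in>Y. x \<otimes> y \<in> Z)"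
  unfolding cmult_def by blast

text \<open>Testing a single \<open>x \<in> X\<close> against \<open>Y = cut bs u b\<close> gives
  the cut with multiplier \<open>u \<otimes> x\<close>. The residual is the intersection of these
  cuts.\<close>

lemma cimp_closed:
  assumes X: "X \<in> cuts" and Y: "Y \<in> cuts"
  shows "cimp X Y \<in> cuts"
proof -
  obtain u b where ub: "u \<in> M" "u \<in> S" "b \<in> set bs" "b \<in> S" "Y = {x \<in> M. u \<otimes> x \<preceq> b}" using Y by (rule cutsE)
  have "x \<otimes> y \<in> Y \<longleftrightarrow> y \<in> cut bs (u \<otimes> x) b" if "x \<in> X" "y \<in> M" for x y
    using cuts_M[OF X that(1)] that ub M_S by (auto simp: cut_eq mult_assoc)
  moreover have "cut bs u b \<subseteq> M" for u by (auto simp: cut_eq)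
  ultimately have "cimp X Y = \<Inter>((\<lambda>x. cut bs (u \<otimes> x) b) ` X)"
    unfolding cimp_def using cuts_nonempty[OF X] by blast
  moreover have "\<Inter>((\<lambda>x. cut bs (u \<otimes> x) b) ` X) \<in> cuts"
    using cuts_M[OF X] cuts_nonempty[OF X] ub M_closed[OF ub(1)]
    by (intro Inter_cuts) (auto simp: cuts_def)
  ultimately show ?thesis by simp
qed

lemma cresid: "X \<in> cuts \<Longrightarrow> Y \<in> cuts \<Longrightarrow> Z \<in> cuts \<Longrightarrow> cmult X Y \<subseteq> Z \<longleftrightarrow> Y \<subseteq> cimp X Z"
  using cuts_M by (auto simp: cmult_subset_iff cimp_def)

lemma cmult_comm: "X \<in> cuts \<Longrightarrow> Y \<in> cuts \<Longrightarrow> cmult X Y = cmult Y X"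
proof -
  assume "X \<in> cuts" "Y \<in> cuts"
  then have "x \<otimes> y = y \<otimes> x" if "x \<in> X" "y \<in> Y" for x y using that cuts_M[of X x] cuts_M[of Y y] by (simp add: M_S mult_comm)
  then have "(\<forall>x\<in>X. \<forall>y\<in>Y. x \<otimes> y \<in> Z) \<longleftrightarrow> (\<forall>x\<in>Y. \<forall>y\<in>X. x \<otimes> y \<in> Z)" for Z by metis
  then show ?thesis unfolding cmult_def by simp
qed

text \<open>A closed product is accessible only through the cuts containing it. Residuation moves
  \<open>X\<close> to the right and leaves the single product \<open>cmult Y Z\<close> against a
  cut, where the closure drops out.\<close>

lemma cmult3_subset_iff:
  assumes XYZ: "X \<in> cuts" "Y \<in> cuts" "Z \<in> cuts" and W: "W \<in> cuts"
  shows "cmult X (cmult Y Z) \<subseteq> W \<longleftrightarrow> (\<forall>x\<in>X. \<forall>y\<in>Y. \<forall>z\<in>Z. x \<otimes> (y \<otimes> z) \<in> W)"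
proof -
  have "cmult X (cmult Y Z) \<subseteq> W \<longleftrightarrow> cmult Y Z \<subseteq> cimp X W"
    using cresid cmult_closed assms by simp
  also have "\<dots> \<longleftrightarrow> (\<forall>x\<in>X. \<forall>y\<in>Y. \<forall>z\<in>Z. x \<otimes> (y \<otimes> z) \<in> W)"
    using assms M_closed cuts_M[OF XYZ(2)] cuts_M[OF XYZ(3)]
    by (simp add: cmult_subset_iff cimp_closed) (auto simp: cimp_def)
  finally show ?thesis .
qed

lemma cmult_assoc:
  assumes "X \<in> cuts" "Y \<in> cuts" "Z \<in> cuts"
  shows "cmult X (cmult Y Z) = cmult (cmult X Y) Z"
proof -
  \<comment> \<open>Both triple products lie in the same cuts and are cuts themselves, so they
    agree. The second has its outer factor first to fit \<open>cmult3_subset_iff\<close>.\<close>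
  have "cmult X (cmult Y Z) \<subseteq> W \<longleftrightarrow> cmult Z (cmult X Y) \<subseteq> W" if "W \<in> cuts" for W
  proof -
    have "x \<otimes> (y \<otimes> z) = z \<otimes> (x \<otimes> y)" if "x \<in> X" "y \<in> Y" "z \<in> Z" for x y z
    proof -
      have "x \<in> S" "y \<in> S" "z \<in> S" using that assms cuts_M M_S by meson+
      then show ?thesis by (simp add: mult_ac)
    qed
    then have "(\<forall>x\<in>X. \<forall>y\<in>Y. \<forall>z\<in>Z. x \<otimes> (y \<otimes> z) \<in> W) \<longleftrightarrow> (\<forall>z\<in>Z. \<forall>x\<in>X. \<forall>y\<in>Y. z \<otimes> (x \<otimes> y) \<in> W)"
      by metis
    then show ?thesis using assms that by (simp add: cmult3_subset_iff)
  qed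
  then have "cmult X (cmult Y Z) = cmult Z (cmult X Y)"
    using assms cmult_closed by (intro equalityI) (metis order.refl)+
  then show ?thesis using cmult_comm cmult_closed assms by simp
qed

lemma cmult_unit:
  assumes X: "X \<in> cuts"
  shows "cmult (below \<one>) X = X"
proof
  have "x \<otimes> y \<in> X" if x: "x \<in> below \<one>" and y: "y \<in> X" for x y
  proof -
    have m: "x \<in> M" "y \<in> M" "x \<preceq> \<one>" using that cuts_M[OF X] by (auto simp: below_eq)
    then have "y \<otimes> x \<preceq> y \<otimes> \<one>" using M_S by (intro mono) auto
    then show ?thesis using down[OF X y] m M_S M_closed[of x y] by (simp add: mult_comm[of y x] del: M_closed)
  qed
  then show "cmult (below \<one>) X \<subseteq> X" using X by (simp add: cmult_subset_iff)
  have "\<one> \<in> below \<one>" using bs_M constants by (simp add: below_eq)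
  then have "\<one> \<otimes> x \<in> Z" if "cmult (below \<one>) X \<subseteq> Z" "Z \<in> cuts" "x \<in> X" for x Z
    using that by (simp add: cmult_subset_iff)
  moreover have "\<one> \<otimes> x = x" if "x \<in> X" for x using that cuts_M[OF X] M_S by simp
  moreover have "cmult (below \<one>) X \<in> cuts" using X below_cuts constants cmult_closed by simp
  ultimately show "X \<subseteq> cmult (below \<one>) X" by fastforce
qed

lemma calg_UL: "UL_alg calg"
proof (rule set_chain_UL_alg)
  show "X \<subseteq> Y \<or> Y \<subseteq> X" if "X \<in> carrier calg" "Y \<in> carrier calg" for X Y
    using that chain by (simp add: calg_def)
  show "X \<subseteq> top_c calg" if "X \<in> carrier calg" for X
    using that cuts_M[of X] by (simp add: calg_def top_eq subset_iff)
  show "mult calg X (mult calg Y Z) = mult calg (mult calg X Y) Z"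
    if "X \<in> carrier calg" "Y \<in> carrier calg" "Z \<in> carrier calg" for X Y Z
    using that cmult_assoc by (simp add: calg_def)
  show "mult calg X Y = mult calg Y X" if "X \<in> carrier calg" "Y \<in> carrier calg" for X Y
    using that by (simp add: calg_def cmult_comm)
qed (simp_all add: calg_def cmult_closed cimp_closed below_cuts constants bot_below cmult_unit cresid)

section \<open>The omega axiom and involution on cuts\<close>

text \<open>Membership of \<open>y\<close> in the residual of \<open>cmult X X\<close> means
  \<open>x \<otimes> x' \<otimes> y \<preceq> \<one>\<close> for all \<open>x\<close> and
  \<open>x'\<close> in \<open>X\<close>. By totality the larger factor may replace the smaller,
  which reduces this to \<open>square_le_one\<close>; the converse takes
  \<open>x' = x\<close>.\<close>

lemma calg_UL_omega: "UL_omega_alg calg"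
  unfolding UL_omega_alg_def
proof (intro conjI ballI calg_UL)
  fix X assume "X \<in> carrier calg"
  then have X: "X \<in> cuts" by (simp add: calg_def)
  have E: "below \<one> \<in> cuts" using below_cuts constants by simp
  have XS: "x \<in> S" if "x \<in> X" for x using that cuts_M[OF X] M_S by blast
  have "y \<in> cimp X (below \<one>) \<longleftrightarrow> y \<in> cimp (cmult X X) (below \<one>)" if y: "y \<in> M" for y
  proof -
    have yS: "y \<in> S" using y M_S by blast
    have elem: "y \<in> cimp Z (below \<one>) \<longleftrightarrow> (\<forall>x\<in>Z. x \<otimes> y \<preceq> \<one>)" if "Z \<in> cuts" for Z
      using y cuts_M[OF that] by (auto simp: cimp_def below_eq)
    \<comment> \<open>The monomials \<open>z\<close> with
      \<open>z \<otimes> y \<preceq> \<one>\<close> form a cut, so testing the closed product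
      against it is testing the pointwise products.\<close>
    have sq: "y \<in> cimp (cmult X X) (below \<one>) \<longleftrightarrow> (\<forall>x\<in>X. \<forall>x'\<in>X. x \<otimes> x' \<otimes> y \<preceq> \<one>)"
    proof -
      have "cut bs y \<one> \<in> cuts" using y constants by (auto simp: cuts_def)
      moreover have "z \<in> cut bs y \<one> \<longleftrightarrow> z \<otimes> y \<preceq> \<one>" if "z \<in> M" for z
        using that yS M_S by (simp add: cut_eq mult_comm)
      moreover have "y \<in> cimp (cmult X X) (below \<one>) \<longleftrightarrow> cmult X X \<subseteq> cut bs y \<one>"
        using elem[OF cmult_closed[OF X X]] cuts_M[OF cmult_closed[OF X X]] calculation(2) by blast
      ultimately show ?thesis using cuts_M[OF X] M_closed by (simp add: cmult_subset_iff)
    qed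
    show ?thesis unfolding elem[OF X] sq
    proof
      assume A: "\<forall>x\<in>X. x \<otimes> y \<preceq> \<one>"
      show "\<forall>x\<in>X. \<forall>x'\<in>X. x \<otimes> x' \<otimes> y \<preceq> \<one>"
      proof (intro ballI)
        fix x x' assume x: "x \<in> X" "x' \<in> X"
        have key: "u \<otimes> w \<otimes> y \<preceq> \<one>" if "u \<in> X" "w \<in> X" "u \<preceq> w" for u w
        proof -
          have s: "u \<in> S" "w \<in> S" using that XS by auto
          have "w \<otimes> (w \<otimes> y) \<preceq> \<one>" using A that s yS square_le_one by simp
          moreover have "(w \<otimes> y) \<otimes> u \<preceq> (w \<otimes> y) \<otimes> w" using that s yS by (intro mono) auto
          ultimately have "(w \<otimes> y) \<otimes> u \<preceq> \<one>"
            using trans[of "(w \<otimes> y) \<otimes> u" "(w \<otimes> y) \<otimes> w" \<one>] s yS by (simp add: mult_comm[of w "w \<otimes> y"])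
          then show ?thesis using s yS by (simp add: mult_ac)
        qed
        show "x \<otimes> x' \<otimes> y \<preceq> \<one>"
          using key[of x x'] key[of x' x] x total[of x x'] XS by (auto simp: mult_comm[of x x'])
      qed
    next
      assume "\<forall>x\<in>X. \<forall>x'\<in>X. x \<otimes> x' \<otimes> y \<preceq> \<one>"
      then have "x \<otimes> (x \<otimes> y) \<preceq> \<one>" if "x \<in> X" for x using that XS[OF that] yS by (simp add: mult_assoc)
      then show "\<forall>x\<in>X. x \<otimes> y \<preceq> \<one>" using XS yS square_le_one by blast
    qed
  qed
  then have "cimp X (below \<one>) = cimp (cmult X X) (below \<one>)" unfolding cimp_def by blast
  then show "imp calg X (unit_e calg) = imp calg (mult calg X X) (unit_e calg)" by (simp add: calg_def)
qed

text \<open>Since \<open>b = neg A (neg A b)\<close>, every cut consists of the monomials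
  \<open>x\<close> with \<open>w \<otimes> x \<preceq> const_f A\<close> for some monomial
  \<open>w\<close>. Such sets are closed for the Galois connection given by
  \<open>x \<otimes> y \<preceq> const_f A\<close>, whose closure is double negation.\<close>

lemma calg_IUL_omega:
  assumes inv: "\<And>x. x \<in> S \<Longrightarrow> neg A (neg A x) = x"
    and neg_bs: "\<And>b. b \<in> set bs \<Longrightarrow> neg A b \<in> set bs"
  shows "IUL_omega_alg calg"
  unfolding IUL_omega_alg_def
proof (intro conjI ballI calg_UL_omega)
  fix X assume "X \<in> carrier calg"
  then have X: "X \<in> cuts" by (simp add: calg_def)
  obtain u b where ub: "u \<in> M" "u \<in> S" "b \<in> set bs" "b \<in> S" "X = {x \<in> M. u \<otimes> x \<preceq> b}" using X by (rule cutsE)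
  define w where "w = neg A b \<otimes> u"
  have nb: "neg A b \<in> M" "neg A b \<in> S" using ub neg_bs bs_M bs_S by auto
  have w: "w \<in> M" "w \<in> S" using nb ub M_S by (auto simp: w_def)
  have "u \<otimes> x \<preceq> b \<longleftrightarrow> w \<otimes> x \<preceq> const_f A" if "x \<in> S" for x
  proof -
    have "u \<otimes> x \<preceq> b \<longleftrightarrow> u \<otimes> x \<preceq> neg A b \<rightharpoonup> const_f A" using inv[OF ub(4)] by (simp add: neg_def)
    also have "\<dots> \<longleftrightarrow> w \<otimes> x \<preceq> const_f A"
      using nb ub that by (simp add: w_def flip: resid mult_assoc)
    finally show ?thesis .
  qed
  then have Xw: "X = {x \<in> M. w \<otimes> x \<preceq> const_f A}" using ub M_S by blast
  have Nx: "x \<otimes> y \<in> below (const_f A) \<longleftrightarrow> x \<otimes> y \<preceq> const_f A" if "x \<in> M" "y \<in> M" for x y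
    using that by (simp add: below_eq)
  let ?N = "\<lambda>X. cimp X (below (const_f A))"
  have N: "?N Y = {y \<in> M. \<forall>x\<in>Y. x \<otimes> y \<preceq> const_f A}" if "Y \<subseteq> M" for Y
    using that Nx unfolding cimp_def by blast
  have XM: "X \<subseteq> M" using Xw by blast
  have NM: "?N X \<subseteq> M" unfolding cimp_def by blast
  \<comment> \<open>As \<open>w\<close> is in the negation of \<open>X\<close>, every member of the
    double negation satisfies the condition that defines \<open>X\<close>.\<close>
  have "w \<in> ?N X" using w M_S mult_comm unfolding N[OF XM] by (auto simp: Xw)
  then have "?N (?N X) \<subseteq> X" unfolding N[OF NM] by (auto simp: Xw)
  moreover have "X \<subseteq> ?N (?N X)"
  proof
    fix x assume x: "x \<in> X"
    then have xM: "x \<in> M" "x \<in> S" using XM M_S by auto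
    have "y \<otimes> x \<preceq> const_f A" if "y \<in> ?N X" for y
      using that x xM M_S mult_comm[of y x] unfolding N[OF XM] by auto
    then show "x \<in> ?N (?N X)" unfolding N[OF NM] using xM by blast
  qed
  ultimately have "?N (?N X) = X" by blast
  then show "neg calg (neg calg X) = X" by (simp add: neg_def calg_def)
qed

section \<open>Generators inside the algebra of cuts\<close>

lemma below_subset_iff: "a \<in> set bs \<Longrightarrow> b \<in> set bs \<Longrightarrow> below a \<subseteq> below b \<longleftrightarrow> a \<preceq> b"
  using bs_M[of a] bs_S[of a] bs_S[of b] M_S trans[of _ a b] R_refl[of a] unfolding below_eq by blast

lemma below_meet: "a \<in> set bs \<Longrightarrow> b \<in> set bs \<Longrightarrow> below (a \<sqinter> b) = below a \<inter> below b"
  using M_S bs_S[of a] bs_S[of b] meet_iff[of a b] by (auto simp: below_eq)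

text \<open>By totality \<open>a \<squnion> b\<close> is equivalent to \<open>a\<close> or to
  \<open>b\<close>, so lying below it means lying below one of them.\<close>

lemma below_join:
  assumes "a \<in> set bs" "b \<in> set bs"
  shows "below (a \<squnion> b) = below a \<union> below b"
proof -
  have S: "a \<in> S" "b \<in> S" using assms bs_S by auto
  then have ge: "a \<preceq> a \<squnion> b" "b \<preceq> a \<squnion> b" by (auto intro: ext)
  have "a \<squnion> b \<preceq> a \<or> a \<squnion> b \<preceq> b" using total[of a b] S by (auto simp: join_iff)
  then have "x \<preceq> a \<squnion> b \<longleftrightarrow> x \<preceq> a \<or> x \<preceq> b" if "x \<in> S" for x
    using that ge S closed(2)[OF S] trans by blast
  then show ?thesis using M_S by (auto simp: below_eq)
qed

text \<open>\<open>a \<otimes> b\<close> is a largest pointwise product: it bounds all of them and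
  lies in every cut that contains them.\<close>

lemma below_mult:
  assumes "a \<in> set bs" "b \<in> set bs" "a \<otimes> b \<in> set bs"
  shows "below (a \<otimes> b) = cmult (below a) (below b)"
proof
  have S: "a \<in> S" "b \<in> S" "a \<in> M" "b \<in> M" using assms bs_S bs_M by auto
  have "x \<otimes> y \<preceq> a \<otimes> b" if "x \<in> S" "y \<in> S" "x \<preceq> a" "y \<preceq> b" for x y
    using that S mono[of x a y] mono[of y b a] trans[of "x \<otimes> y" "a \<otimes> y" "a \<otimes> b"] by (simp add: mult_comm[of y])
  then have "\<forall>x\<in>below a. \<forall>y\<in>below b. x \<otimes> y \<in> below (a \<otimes> b)"
    using M_S by (simp add: below_eq)
  then show "cmult (below a) (below b) \<subseteq> below (a \<otimes> b)"
    using below_cuts[OF assms(3)] by (simp add: cmult_subset_iff)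
  have "a \<in> below a" "b \<in> below b" using S by (simp_all add: below_eq)
  then have "a \<otimes> b \<in> cmult (below a) (below b)" by (auto simp: cmult_def)
  then show "below (a \<otimes> b) \<subseteq> cmult (below a) (below b)"
    using down[OF cmult_closed] assms below_cuts by (auto simp: below_eq[of "a \<otimes> b"])
qed

text \<open>\<open>a\<close> is a largest element of \<open>below a\<close>, so the condition on all
  its elements is equivalent to the one on \<open>a\<close>.\<close>

lemma below_imp:
  assumes "a \<in> set bs" "b \<in> set bs" "a \<rightharpoonup> b \<in> set bs"
  shows "below (a \<rightharpoonup> b) = cimp (below a) (below b)"
proof -
  have S: "a \<in> S" "b \<in> S" "a \<in> M" "b \<in> M" using assms bs_S bs_M by auto
  have "y \<preceq> a \<rightharpoonup> b \<longleftrightarrow> (\<forall>x\<in>below a. x \<otimes> y \<in> below b)" if y: "y \<in> M" for y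
  proof
    assume "y \<preceq> a \<rightharpoonup> b"
    then have 1: "y \<otimes> a \<preceq> b" using S y M_S by (simp add: mult_comm[of y] resid)
    show "\<forall>x\<in>below a. x \<otimes> y \<in> below b"
    proof
      fix x assume "x \<in> below a"
      then have x: "x \<in> M" "x \<in> S" "x \<preceq> a" using M_S by (auto simp: below_eq)
      have "y \<otimes> x \<preceq> b"
        using trans[OF _ _ _ mono[OF x(3), of y] 1] x S M_S[OF y] by simp
      then show "x \<otimes> y \<in> below b" using x y M_S[OF y] by (simp add: below_eq mult_comm[of y x])
    qed
  next
    assume A: "\<forall>x\<in>below a. x \<otimes> y \<in> below b"
    have "a \<in> below a" using S by (simp add: below_eq)
    then have "a \<otimes> y \<preceq> b" using A by (auto simp: below_eq)
    then show "y \<preceq> a \<rightharpoonup> b" using S y M_S by (simp add: resid)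
  qed
  then show ?thesis unfolding cimp_def below_eq[of "a \<rightharpoonup> b"] by blast
qed

end

section \<open>Partial homomorphisms and finite products\<close>

text \<open>A partial embedding without injectivity and order reflection: a single chain has to
  separate only one pair, and reflection is regained in the product.\<close>

definition partial_hom :: "'a ul_alg \<Rightarrow> 'a set \<Rightarrow> 'b ul_alg \<Rightarrow> ('a \<Rightarrow> 'b) \<Rightarrow> bool" where
  "partial_hom A B C h \<longleftrightarrow>
     h ` B \<subseteq> carrier C
   \<and> (\<forall>a\<in>B. \<forall>b\<in>B. leq A a b \<longrightarrow> leq C (h a) (h b))
   \<and> (\<forall>a\<in>B. \<forall>b\<in>B.
        (meet A a b \<in> B \<longrightarrow> h (meet A a b) = meet C (h a) (h b))
      \<and> (join A a b \<in> B \<longrightarrow> h (join A a b) = join C (h a) (h b))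
      \<and> (mult A a b \<in> B \<longrightarrow> h (mult A a b) = mult C (h a) (h b))
      \<and> (imp A a b \<in> B \<longrightarrow> h (imp A a b) = imp C (h a) (h b)))
   \<and> (unit_e A \<in> B \<longrightarrow> h (unit_e A) = unit_e C)
   \<and> (const_f A \<in> B \<longrightarrow> h (const_f A) = const_f C)
   \<and> (bot_c A \<in> B \<longrightarrow> h (bot_c A) = bot_c C)
   \<and> (top_c A \<in> B \<longrightarrow> h (top_c A) = top_c C)"

text \<open>The full product has finitely many tuples, which an injection \<open>g\<close> codes as
  natural numbers. Operations decode by \<open>q\<close>, act coordinatewise and encode again; the
  last conclusion says that every tuple occurs.\<close>

lemma finite_product_nat:
  fixes C :: "'i \<Rightarrow> 'c ul_alg"
  assumes I: "finite I" and UL: "\<And>i. i \<in> I \<Longrightarrow> UL_alg (C i)" and fin: "\<And>i. i \<in> I \<Longrightarrow> finite (carrier (C i))"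
  obtains D :: "nat ul_alg" and p where "subdirect D I C p" "finite (carrier D)"
    "\<And>t. (\<And>i. i \<in> I \<Longrightarrow> t i \<in> carrier (C i)) \<Longrightarrow> \<exists>x\<in>carrier D. \<forall>i\<in>I. p i x = t i"
proof -
  define P where "P = PiE I (\<lambda>i. carrier (C i))"
  have finP: "finite P" unfolding P_def using I fin by (intro finite_PiE)
  obtain g :: "('i \<Rightarrow> 'c) \<Rightarrow> nat" where g: "inj_on g P"
    using finite_imp_inj_to_nat_seg[OF finP] by blast
  define q where "q = the_inv_into P g"
  have qg: "q (g t) = t" if "t \<in> P" for t using g that by (simp add: q_def the_inv_into_f_f)
  have qP: "q x \<in> P" if "x \<in> g ` P" for x using that qg by auto
  define op2 where "op2 = (\<lambda>f x y. g (\<lambda>i\<in>I. f (C i) (q x i) (q y i)))"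
  define op0 where "op0 = (\<lambda>f. g (\<lambda>i\<in>I. f (C i)))"
  define D where "D = \<lparr>carrier = g ` P, meet = op2 meet, join = op2 join, mult = op2 mult, imp = op2 imp,
     unit_e = op0 unit_e, const_f = op0 const_f, bot_c = op0 bot_c, top_c = op0 top_c\<rparr>"
  have U: "ul (C i)" if "i \<in> I" for i using UL[OF that] by unfold_locales
  have tP: "(\<lambda>i\<in>I. t i) \<in> P" if "\<And>i. i \<in> I \<Longrightarrow> t i \<in> carrier (C i)" for t
    using that by (auto simp: P_def)
  have q: "q x i \<in> carrier (C i)" if "x \<in> g ` P" "i \<in> I" for x i
    using qP[OF that(1)] that(2) by (auto simp: P_def)
  have op2: "op2 f x y \<in> g ` P" "\<And>i. i \<in> I \<Longrightarrow> q (op2 f x y) i = f (C i) (q x i) (q y i)"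
    if "x \<in> g ` P" "y \<in> g ` P"
      and "\<And>i a b. i \<in> I \<Longrightarrow> a \<in> carrier (C i) \<Longrightarrow> b \<in> carrier (C i) \<Longrightarrow> f (C i) a b \<in> carrier (C i)" for f x y
    using tP[of "\<lambda>i. f (C i) (q x i) (q y i)"] that q by (simp_all add: op2_def qg)
  have op0: "op0 f \<in> g ` P" "\<And>i. i \<in> I \<Longrightarrow> q (op0 f) i = f (C i)"
    if "\<And>i. i \<in> I \<Longrightarrow> f (C i) \<in> carrier (C i)" for f
    using tP[of "\<lambda>i. f (C i)"] that by (simp_all add: op0_def qg)
  have "subdirect D I C (\<lambda>i x. q x i)"
  proof unfold_locales
    fix x y assume xy: "x \<in> carrier D" "y \<in> carrier D" "\<And>i. i \<in> I \<Longrightarrow> q x i = q y i"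
    then have "q x \<in> P" "q y \<in> P" using qP by (simp_all add: D_def)
    then have "q x = q y" using xy(3) unfolding P_def by (intro PiE_ext) auto
    then show "x = y" using xy g by (auto simp: D_def qg)
  qed (simp_all add: D_def op2 op0 q ul.closed[OF U])
  moreover have "finite (carrier D)" using finP by (simp add: D_def)
  moreover have "\<exists>x\<in>carrier D. \<forall>i\<in>I. q x i = t i" if "\<And>i. i \<in> I \<Longrightarrow> t i \<in> carrier (C i)" for t
    using tP[OF that] qg[OF tP[OF that]] by (intro bexI[of _ "g (\<lambda>i\<in>I. t i)"]) (simp_all add: D_def)
  ultimately show ?thesis using that by blast
qed

text \<open>One separating coordinate for each incomparable or reversed pair makes the order
  reflected; injectivity then follows by antisymmetry.\<close>

lemma (in subdirect) partial_embedding: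
  assumes A: "UL_alg A" and B: "B \<subseteq> carrier A"
    and h: "\<And>i. i \<in> I \<Longrightarrow> partial_hom A B (C i) (h i)"
    and refl: "\<And>a b. a \<in> B \<Longrightarrow> b \<in> B \<Longrightarrow> \<not> leq A a b \<Longrightarrow> \<exists>i\<in>I. \<not> leq (C i) (h i a) (h i b)"
    and \<iota>: "\<And>b. b \<in> B \<Longrightarrow> \<iota> b \<in> carrier D" "\<And>b i. b \<in> B \<Longrightarrow> i \<in> I \<Longrightarrow> p i (\<iota> b) = h i b"
  shows "partial_embedding A B D \<iota>"
proof -
  interpret A: ul A using A by unfold_locales
  note ph = h[unfolded partial_hom_def]
  have leq: "leq A a b \<longleftrightarrow> leq D (\<iota> a) (\<iota> b)" if "a \<in> B" "b \<in> B" for a b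
  proof -
    have "leq D (\<iota> a) (\<iota> b) \<longleftrightarrow> (\<forall>i\<in>I. leq (C i) (h i a) (h i b))"
      using that \<iota> by (simp add: leq_iff)
    then show ?thesis using refl[OF that] ph that by blast
  qed
  have "inj_on \<iota> B"
  proof (rule inj_onI)
    fix a b assume ab: "a \<in> B" "b \<in> B" "\<iota> a = \<iota> b"
    then have "leq A a b" "leq A b a" using leq[of a a] leq[of a b] leq[of b a] B A.le_refl by auto
    then show "a = b" using A.le_antisym ab B by blast
  qed
  moreover have "\<iota> (meet A a b) = meet D (\<iota> a) (\<iota> b)" if "a \<in> B" "b \<in> B" "meet A a b \<in> B" for a b
    using that \<iota> ph by (intro sep) simp_all
  moreover have "\<iota> (join A a b) = join D (\<iota> a) (\<iota> b)" if "a \<in> B" "b \<in> B" "join A a b \<in> B" for a b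
    using that \<iota> ph by (intro sep) simp_all
  moreover have "\<iota> (mult A a b) = mult D (\<iota> a) (\<iota> b)" if "a \<in> B" "b \<in> B" "mult A a b \<in> B" for a b
    using that \<iota> ph by (intro sep) simp_all
  moreover have "\<iota> (imp A a b) = imp D (\<iota> a) (\<iota> b)" if "a \<in> B" "b \<in> B" "imp A a b \<in> B" for a b
    using that \<iota> ph by (intro sep) simp_all
  moreover have "\<iota> (unit_e A) = unit_e D" if "unit_e A \<in> B" using that \<iota> ph by (intro sep) simp_all
  moreover have "\<iota> (const_f A) = const_f D" if "const_f A \<in> B" using that \<iota> ph by (intro sep) simp_all
  moreover have "\<iota> (bot_c A) = bot_c D" if "bot_c A \<in> B" using that \<iota> ph by (intro sep) simp_all
  moreover have "\<iota> (top_c A) = top_c D" if "top_c A \<in> B" using that \<iota> ph by (intro sep) simp_all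
  ultimately show ?thesis unfolding partial_embedding_def using leq \<iota>(1) by auto
qed

lemma (in cut_algebra) partial_hom_below:
  assumes "B \<subseteq> set bs"
  shows "partial_hom A B calg below"
proof -
  have leq: "leq calg X Y \<longleftrightarrow> X \<subseteq> Y" for X Y by (auto simp: leq_def calg_def)
  have sub: "b \<in> set bs" if "b \<in> B" for b using that assms by blast
  show ?thesis unfolding partial_hom_def leq
  proof (intro conjI ballI impI)
    show "below ` B \<subseteq> carrier calg" using below_cuts sub by (auto simp: calg_def)
    show "below a \<subseteq> below b" if "a \<in> B" "b \<in> B" "a \<sqsubseteq> b" for a b
      using below_subset_iff[OF sub sub, OF that(1,2)] ext[OF bs_S bs_S, OF sub sub] that by blast
  qed (simp_all add: sub calg_def below_meet below_join below_mult below_imp)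
qed

section \<open>Finite embeddability\<close>

text \<open>Each factor is the algebra of cuts of a preorder separating the given pair, with
  \<open>B\<close> as the generators. The involutive case is an implication, so that one
  construction serves both varieties.\<close>

lemma UL_omega_finite_factors:
  assumes A: "UL_omega_alg A" and B: "finite B" "B \<subseteq> carrier A"
    and constants: "unit_e A \<in> B" "const_f A \<in> B" "bot_c A \<in> B" "top_c A \<in> B"
  shows "\<exists>(C :: 'a \<times> 'a \<Rightarrow> 'a set ul_alg) h. \<forall>i\<in>{(a, b) \<in> B \<times> B. \<not> leq A a b}.
       UL_omega_alg (C i) \<and> finite (carrier (C i)) \<and> partial_hom A B (C i) (h i)
       \<and> ((\<forall>x\<in>carrier A. neg A (neg A x) = x) \<and> (\<forall>b\<in>B. neg A b \<in> B) \<longrightarrow> IUL_omega_alg (C i))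
       \<and> \<not> leq (C i) (h i (fst i)) (h i (snd i))"
proof -
  interpret ul A using A by unfold_locales (simp add: UL_omega_alg_def)
  obtain bs where bs: "set bs = B" "distinct bs" using finite_distinct_list[OF B(1)] by blast
  have "\<exists>(C :: 'a set ul_alg) h. UL_omega_alg C \<and> finite (carrier C) \<and> partial_hom A B C h
       \<and> ((\<forall>x\<in>carrier A. neg A (neg A x) = x) \<and> (\<forall>b\<in>B. neg A b \<in> B) \<longrightarrow> IUL_omega_alg C)
       \<and> \<not> leq C (h a) (h b)" if ab: "a \<in> B" "b \<in> B" "\<not> leq A a b" for a b
  proof -
    obtain R where R: "ul_preorder A R" "\<not> R a b" using preorder_exists[of a b] ab B by blast
    interpret R: ul_preorder A R by fact
    interpret R: cut_algebra A R bs
    proof unfold_locales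
      show "imp A x \<one> = imp A (mult A x x) \<one>" if "x \<in> S" for x
        using A that unfolding UL_omega_alg_def by blast
    qed (use B bs constants in simp_all)
    have "\<not> leq R.calg (R.below a) (R.below b)"
      using R.below_subset_iff[of a b] R(2) ab bs by (auto simp: leq_def R.calg_def)
    moreover have "finite (carrier R.calg)" using R.finite_cuts_set by (simp add: R.calg_def)
    ultimately show ?thesis
      using R.calg_UL_omega R.calg_IUL_omega R.partial_hom_below[of B] bs(1) by blast
  qed
  \<comment> \<open>Membership of \<open>i\<close> is a premise inside \<open>Q\<close>, so that the
    choice of factors runs over all pairs.\<close>
  moreover define Q where "Q i C h \<longleftrightarrow> (i \<in> {(a, b) \<in> B \<times> B. \<not> leq A a b} \<longrightarrow>
      UL_omega_alg C \<and> finite (carrier C) \<and> partial_hom A B C h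
      \<and> ((\<forall>x\<in>carrier A. neg A (neg A x) = x) \<and> (\<forall>b\<in>B. neg A b \<in> B) \<longrightarrow> IUL_omega_alg C)
      \<and> \<not> leq C (h (fst i)) (h (snd i)))" for i :: "'a \<times> 'a" and C :: "'a set ul_alg" and h
  ultimately have "\<forall>i. \<exists>C h. Q i C h" by auto
  then obtain C h where "\<forall>i. Q i (C i) (h i)" by metis
  then show ?thesis unfolding Q_def by blast
qed

lemma partial_embedding_subset:
  assumes "partial_embedding A B C \<iota>" "B' \<subseteq> B"
  shows "partial_embedding A B' C \<iota>"
  using assms inj_on_subset[of \<iota> B B'] unfolding partial_embedding_def by (auto simp: subset_iff)

text \<open>The embedding sends \<open>b\<close> to the tuple of its images in the separating
  factors.\<close>

lemma UL_omega_finite_embedding: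
  fixes A :: "'a ul_alg"
  assumes A: "UL_omega_alg A" and B: "finite B" "B \<subseteq> carrier A"
    and constants: "unit_e A \<in> B" "const_f A \<in> B" "bot_c A \<in> B" "top_c A \<in> B"
  obtains D :: "nat ul_alg" and \<iota> where "UL_omega_alg D" "finite (carrier D)" "partial_embedding A B D \<iota>"
    "(\<forall>x\<in>carrier A. neg A (neg A x) = x) \<Longrightarrow> (\<forall>b\<in>B. neg A b \<in> B) \<Longrightarrow> IUL_omega_alg D"
proof -
  define I where "I = {(a, b) \<in> B \<times> B. \<not> leq A a b}"
  obtain C :: "'a \<times> 'a \<Rightarrow> 'a set ul_alg" and h where
    C: "\<And>i. i \<in> I \<Longrightarrow> UL_omega_alg (C i) \<and> finite (carrier (C i)) \<and> partial_hom A B (C i) (h i)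
       \<and> ((\<forall>x\<in>carrier A. neg A (neg A x) = x) \<and> (\<forall>b\<in>B. neg A b \<in> B) \<longrightarrow> IUL_omega_alg (C i))
       \<and> \<not> leq (C i) (h i (fst i)) (h i (snd i))"
    using UL_omega_finite_factors[OF assms, folded I_def] by blast
  have "finite I" using B by (auto simp: I_def intro: finite_subset[of _ "B \<times> B"])
  moreover have "UL_alg (C i)" "finite (carrier (C i))" if "i \<in> I" for i
    using C[OF that] by (auto simp: UL_omega_alg_def)
  ultimately obtain D :: "nat ul_alg" and p where D: "subdirect D I C p" "finite (carrier D)"
    and surj: "\<And>t. (\<And>i. i \<in> I \<Longrightarrow> t i \<in> carrier (C i)) \<Longrightarrow> \<exists>x\<in>carrier D. \<forall>i\<in>I. p i x = t i"
    using finite_product_nat[of I C] by blast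
  interpret subdirect D I C p by (rule D)
  have "\<exists>x\<in>carrier D. \<forall>i\<in>I. p i x = h i b" if "b \<in> B" for b
  proof (rule surj)
    show "h i b \<in> carrier (C i)" if "i \<in> I" for i
      using C[OF that] \<open>b \<in> B\<close> by (auto simp: partial_hom_def)
  qed
  then obtain \<iota> where \<iota>: "\<And>b. b \<in> B \<Longrightarrow> \<iota> b \<in> carrier D" "\<And>b i. b \<in> B \<Longrightarrow> i \<in> I \<Longrightarrow> p i (\<iota> b) = h i b"
    by metis
  have "partial_embedding A B D \<iota>"
  proof (rule partial_embedding[OF _ B(2)])
    show "UL_alg A" using A by (simp add: UL_omega_alg_def)
    show "\<exists>i\<in>I. \<not> leq (C i) (h i a) (h i b)" if "a \<in> B" "b \<in> B" "\<not> leq A a b" for a b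
      using that C[of "(a, b)"] by (intro bexI[of _ "(a, b)"]) (simp_all add: I_def)
  qed (use C \<iota> in auto)
  then show ?thesis
    using C by (intro that[of D \<iota>] UL_omega_alg IUL_omega_alg D(2)) simp_all
qed

theorem theorem4p9:
  shows "FEP (UL_omega_alg :: 'a ul_alg \<Rightarrow> bool) (UL_omega_alg :: nat ul_alg \<Rightarrow> bool)
       \<and> FEP (IUL_omega_alg :: 'a ul_alg \<Rightarrow> bool) (IUL_omega_alg :: nat ul_alg \<Rightarrow> bool)"
proof
  show "FEP (UL_omega_alg :: 'a ul_alg \<Rightarrow> bool) (UL_omega_alg :: nat ul_alg \<Rightarrow> bool)"
    unfolding FEP_def
  proof (intro allI impI, elim conjE)
    fix A :: "'a ul_alg" and B assume A: "UL_omega_alg A" and B: "finite B" "B \<subseteq> carrier A"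
    interpret ul A using A by unfold_locales (simp add: UL_omega_alg_def)
    \<comment> \<open>The algebra of cuts requires the constants among the generators; the embedding
      is restricted to \<open>B\<close> afterwards.\<close>
    let ?B = "B \<union> {unit_e A, const_f A, bot_c A, top_c A}"
    obtain D :: "nat ul_alg" and \<iota> where "UL_omega_alg D" "finite (carrier D)" "partial_embedding A ?B D \<iota>"
      by (rule UL_omega_finite_embedding[OF A, of ?B]) (use B in auto)
    then show "\<exists>(D :: nat ul_alg) \<iota>. UL_omega_alg D \<and> finite (carrier D) \<and> partial_embedding A B D \<iota>"
      using partial_embedding_subset by blast
  qed
  show "FEP (IUL_omega_alg :: 'a ul_alg \<Rightarrow> bool) (IUL_omega_alg :: nat ul_alg \<Rightarrow> bool)"
    unfolding FEP_def
  proof (intro allI impI, elim conjE)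
    fix A :: "'a ul_alg" and B assume I: "IUL_omega_alg A" and B: "finite B" "B \<subseteq> carrier A"
    then have A: "UL_omega_alg A" and inv: "\<forall>x\<in>carrier A. neg A (neg A x) = x"
      by (auto simp: IUL_omega_alg_def)
    interpret ul A using A by unfold_locales (simp add: UL_omega_alg_def)
    let ?G = "B \<union> {unit_e A, const_f A, bot_c A, top_c A}"
    \<comment> \<open>One round of negations closes the set under negation, which is
      involutive.\<close>
    let ?B = "?G \<union> neg A ` ?G"
    have B0: "finite ?G" "?G \<subseteq> carrier A" using B by auto
    have neg: "neg A x \<in> carrier A" if "x \<in> carrier A" for x using that by (simp add: neg_def)
    have closed_B: "\<forall>b\<in>?B. neg A b \<in> ?B"
    proof
      fix b assume "b \<in> ?B"
      then consider "b \<in> ?G" | c where "c \<in> ?G" "b = neg A c" by blast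
      then show "neg A b \<in> ?B" using inv B0(2) by cases (blast, metis UnI1 subsetD)
    qed
    have finB: "finite ?B" using B0(1) by blast
    have subB: "?B \<subseteq> carrier A" using B0(2) neg by blast
    show "\<exists>(D :: nat ul_alg) \<iota>. IUL_omega_alg D \<and> finite (carrier D) \<and> partial_embedding A B D \<iota>"
    proof (rule UL_omega_finite_embedding[OF A finB subB])
      fix D :: "nat ul_alg" and \<iota>
      assume D: "finite (carrier D)" "partial_embedding A ?B D \<iota>"
        and IUL: "(\<forall>x\<in>carrier A. neg A (neg A x) = x) \<Longrightarrow> (\<forall>b\<in>?B. neg A b \<in> ?B) \<Longrightarrow> IUL_omega_alg D"
      have "partial_embedding A B D \<iota>" by (rule partial_embedding_subset[OF D(2)]) blast
      then show ?thesis using D(1) IUL[OF inv closed_B] by blast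
    qed simp_all
  qed
qed

end
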